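(* Let $\emptyset\ne M\subset\mathbb{R}^3$ be closed. Then $M$ is a strict sun in $\ell^\infty(3)$ if and only if $M$ is (1) strictly $\ell^1$-convex and (2) not an $\mathbb{R}^3$-cross.
   Context: $\ell^\infty(3)$ is the real vector space $\mathbb{R}^3$ with the norm $\|x\|=\max\{|x_1|,|x_2|,|x_3|\}$. **Strict sun.** A subset $M$ of a real normed linear space $X$ is a strict sun if, for every $x\in X\setminus M$, (i) the set $\{y\in M : \|x-y\|=\inf_{z\in M}\|x-z\|\}$ of nearest points from $M$ to $x$ is non-empty, and (ii) whenever $y\in M$ is a nearest point from $M$ to $x$, then $y$ is a nearest point from $M$ to every point of the ray $\{\lambda x+(1-\lambda)y : \lambda>0\}$. **Equal coordinates.** For $M\subset\mathbb{R}^3$ put $\operatorname{eqc}(M)=\{j\in\{1,2,3\} : x_j=y_j \text{ for all } x,y\in M\}$. For $x,y\in\mathbb{R}^3$ write $\operatorname{eqc}(x,y)=\operatorname{eqc}(\{x,y\})=\{j : x_j=y_j\}$. **$\ell^1$-convexity.** A set $M\subset\mathbb{R}^3$ is $\ell^1$-convex if any two points $x,y\in M$ can be connected by an $\ell^1$-geodesic segment contained in $M$, i.e. there is a continuous curve $k:[0,1]\to M$ with $k(0)=x$, $k(1)=y$ all of whose coordinate functions $k_i$ are monotonic in $t$ (not necessarily strictly). (For closed $M$ this is equivalent to: for all $x,y\in M$ with $x\neq y$ there is $z\in M$, $z\ne x$, $z\neq y$, with $\|x-y\|_{\ell^1}=\|x-z\|_{\ell^1}+\|z-y\|_{\ell^1}$.)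 **Strict $\ell^1$-convexity.** A set $M\subset\mathbb{R}^3$ is strictly $\ell^1$-convex if it is $\ell^1$-convex and, for every $x,y\in M$ with $x_j\ne y_j$ for all $j\notin\operatorname{eqc}(M)$, there is a continuous curve $k:[0,1]\to M$ with $k(0)=x$, $k(1)=y$ such that every coordinate function $k_j$ is monotonic in $t$, and $k_j$ is strictly monotonic for each $j\notin\operatorname{eqc}(M)$. **Cross.** For $x\in\mathbb{R}^3$ the main cross at $x$ is $\operatorname{cr}(x)=\{y\in\mathbb{R}^3 : \operatorname{card}\operatorname{eqc}(x,y)\ge 2\}$. An $\mathbb{R}^3$-cross is a set $C\subset\mathbb{R}^3$ such that $C\subset\operatorname{cr}(x)$ for some $x\in\mathbb{R}^3$ and $\operatorname{eqc}(C)=\emptyset$. *)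

theory Defs
  imports "HOL-Analysis.Analysis"
begin

text \<open>The type \<^typ>\<open>real ^ 3\<close> carries the Euclidean norm as its type-class norm, so the notions
  from approximation theory take the norm \<open>N\<close> as an argument; the space $\ell^\infty(3)$ is
  \<^typ>\<open>real ^ 3\<close> with \<open>N = infnorm\<close>. The type-class topology is also the one induced by
  \<^const>\<open>infnorm\<close>, all norms on \<^typ>\<open>real ^ 3\<close> being equivalent.\<close>

lemma infnorm_vec3: "infnorm (x :: real ^ 3) = Max {\<bar>x $ 1\<bar>, \<bar>x $ 2\<bar>, \<bar>x $ 3\<bar>}"
proof -
  have "{\<bar>x $ i\<bar> | i. i \<in> UNIV} = {\<bar>x $ 1\<bar>, \<bar>x $ 2\<bar>, \<bar>x $ 3\<bar>}"
    unfolding UNIV_3 by blast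
  then show ?thesis
    by (simp add: infnorm_cart cSup_eq_Max)
qed

definition nearest_points :: "('a::real_vector \<Rightarrow> real) \<Rightarrow> 'a set \<Rightarrow> 'a \<Rightarrow> 'a set" where
  "nearest_points N M x = {y \<in> M. N (x - y) = (INF z\<in>M. N (x - z))}"

definition strict_sun :: "('a::real_vector \<Rightarrow> real) \<Rightarrow> 'a set \<Rightarrow> bool" where
  "strict_sun N M \<longleftrightarrow>
     (\<forall>x. x \<notin> M \<longrightarrow>
        nearest_points N M x \<noteq> {} \<and>
        (\<forall>y \<in> nearest_points N M x. \<forall>l>0. y \<in> nearest_points N M (l *\<^sub>R x + (1 - l) *\<^sub>R y)))"

definition eqc :: "(real ^ 3) set \<Rightarrow> 3 set" where
  "eqc M = {j. \<forall>x\<in>M. \<forall>y\<in>M. x $ j = y $ j}"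

definition l1_convex :: "(real ^ 3) set \<Rightarrow> bool" where
  "l1_convex M \<longleftrightarrow>
     (\<forall>x\<in>M. \<forall>y\<in>M. \<exists>k. path k \<and> path_image k \<subseteq> M \<and> pathstart k = x \<and> pathfinish k = y \<and>
        (\<forall>j. mono_on {0..1} (\<lambda>t. k t $ j) \<or> antimono_on {0..1} (\<lambda>t. k t $ j)))"

definition strictly_l1_convex :: "(real ^ 3) set \<Rightarrow> bool" where
  "strictly_l1_convex M \<longleftrightarrow> l1_convex M \<and>
     (\<forall>x\<in>M. \<forall>y\<in>M. (\<forall>j. j \<notin> eqc M \<longrightarrow> x $ j \<noteq> y $ j) \<longrightarrow>
        (\<exists>k. path k \<and> path_image k \<subseteq> M \<and> pathstart k = x \<and> pathfinish k = y \<and>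
           (\<forall>j. mono_on {0..1} (\<lambda>t. k t $ j) \<or> antimono_on {0..1} (\<lambda>t. k t $ j)) \<and>
           (\<forall>j. j \<notin> eqc M \<longrightarrow>
              strict_mono_on {0..1} (\<lambda>t. k t $ j) \<or> strict_antimono_on {0..1} (\<lambda>t. k t $ j))))"

definition main_cross :: "real ^ 3 \<Rightarrow> (real ^ 3) set" where
  "main_cross x = {y. card (eqc {x, y}) \<ge> 2}"

definition R3_cross :: "(real ^ 3) set \<Rightarrow> bool" where
  "R3_cross C \<longleftrightarrow> (\<exists>x. C \<subseteq> main_cross x) \<and> eqc C = {}"

end

theory Submission
  imports Defs
begin

text \<open>
  Both properties are compared with a third one, called \<open>approachable\<close> below: if
  \<open>y\<close> and \<open>z\<close> are points of \<open>M\<close>, then \<open>y\<close> is a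
  limit of points of \<open>M\<close> that lie, in each coordinate where \<open>z\<close> differs
  from \<open>y\<close>, strictly on the same side of \<open>y\<close> as \<open>z\<close>. Balls
  of \<open>infnorm\<close> are cubes, and the union of the open cubes centred on a ray from
  \<open>y\<close> and touching \<open>y\<close> is a cone defined by the signs of some
  coordinates of \<open>z - y\<close>. Hence a closed set is a strict sun if and only if it is
  approachable (\<open>strict_sun_imp_approachable\<close>,
  \<open>approachable_imp_strict_sun\<close>).

  For a strictly $\ell^1$-convex set, approachability is evident when \<open>y\<close> and
  \<open>z\<close> differ in all coordinates that are not constant on \<open>M\<close>: follow a
  strictly monotonic curve. It is also evident when they differ in one coordinate, where a
  monotonic curve is a segment. In dimension three there remains the case where they differ in two
  coordinates and the third one is not constant on \<open>M\<close>. If \<open>z\<close> cannot be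
  moved out of the coordinate plane that it shares with \<open>y\<close>, the strict curves
  towards points outside this plane confine \<open>M\<close> to a cross
  (\<open>strictly_l1_convex_one_sided_cross\<close>).

  Conversely, an approachable set is clearly no cross. The main point is to construct curves. An
  extremal argument shows that between any two points \<open>x\<close>, \<open>y\<close> of a
  closed approachable set, every intermediate value of every coordinate is attained in the part of
  \<open>M\<close> within the coordinate box spanned by \<open>x\<close> and \<open>y\<close>
  (\<open>approachable_level\<close>). Splitting the longest edge of the box in this way, and
  repeating this for the two smaller boxes, yields a monotonic curve in the limit
  (\<open>bisection_path\<close>). To make it strict, the two corners are moved towards each other
  before each splitting (\<open>approachable_strict_midpoint\<close>).
\<close>

section \<open>Strict suns are the approachable closed sets\<close>

text \<open>
  This is the local form of being a strict sun. The open balls with centres on a ray issuing from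
  \<open>y\<close>, all touching \<open>y\<close>, increase to an open cone \<open>{z. sgn (z $ j
  - y $ j) = \<epsilon> j for all j \<in> J}\<close>, where \<open>J\<close> is the set of
  coordinates in which the direction of the ray attains its norm; near \<open>y\<close> each of
  these balls coincides with the cone. So the strict sun property says that whenever
  \<open>M\<close> meets such a cone, it does so arbitrarily close to \<open>y\<close>. Given a
  point \<open>z\<close> of \<open>M\<close>, the smallest of the cones at \<open>y\<close> that
  contain it is the one in which \<open>J\<close> consists of all coordinates where
  \<open>z\<close> and \<open>y\<close> differ, and it suffices to consider that one.
\<close>

definition approachable :: "(real ^ 'n) set \<Rightarrow> bool" where
  "approachable M \<longleftrightarrow> (\<forall>y\<in>M. \<forall>z\<in>M. \<forall>e>0. \<exists>w\<in>M. \<forall>j.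
     \<bar>w $ j - y $ j\<bar> < e \<and> (z $ j \<noteq> y $ j \<longrightarrow> (w $ j - y $ j) * (z $ j - y $ j) > 0))"

lemma approachableD:
  assumes "approachable M" "y \<in> M" "z \<in> M" "e > 0"
  obtains w where "w \<in> M" "\<And>j. \<bar>w $ j - y $ j\<bar> < e"
    "\<And>j. z $ j \<noteq> y $ j \<Longrightarrow> (w $ j - y $ j) * (z $ j - y $ j) > 0"
  using assms unfolding approachable_def by meson

lemma infnorm_cart_Max: "infnorm (x :: real ^ 'n) = Max (range (\<lambda>i. \<bar>x $ i\<bar>))"
proof -
  have "{\<bar>x $ i\<bar> | i. i \<in> UNIV} = range (\<lambda>i. \<bar>x $ i\<bar>)" by auto
  then show ?thesis by (simp add: infnorm_cart cSup_eq_Max)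
qed

lemma infnorm_less_iff_cart: "infnorm (x :: real ^ 'n) < r \<longleftrightarrow> (\<forall>j. \<bar>x $ j\<bar> < r)"
  by (simp add: infnorm_cart_Max)

lemma infnorm_le_iff_cart: "infnorm (x :: real ^ 'n) \<le> r \<longleftrightarrow> (\<forall>j. \<bar>x $ j\<bar> \<le> r)"
  by (simp add: infnorm_cart_Max)

lemma nearest_points_infnorm_iff:
  fixes M :: "(real ^ 'n) set"
  shows "y \<in> nearest_points infnorm M x \<longleftrightarrow> y \<in> M \<and> (\<forall>z\<in>M. infnorm (x - y) \<le> infnorm (x - z))"
proof -
  have bdd: "bdd_below ((\<lambda>z. infnorm (x - z)) ` M)"
    by (rule bdd_belowI[of _ 0]) (auto simp: infnorm_pos_le)
  show ?thesis
  proof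
    assume "y \<in> nearest_points infnorm M x"
    then show "y \<in> M \<and> (\<forall>z\<in>M. infnorm (x - y) \<le> infnorm (x - z))"
      using cINF_lower[OF bdd] by (auto simp: nearest_points_def)
  next
    assume y: "y \<in> M \<and> (\<forall>z\<in>M. infnorm (x - y) \<le> infnorm (x - z))"
    then have "infnorm (x - y) = (INF z\<in>M. infnorm (x - z))"
      by (intro antisym cINF_greatest cINF_lower[OF bdd]) auto
    then show "y \<in> nearest_points infnorm M x" using y by (simp add: nearest_points_def)
  qed
qed

lemma nearest_points_infnorm_nonempty:
  fixes M :: "(real ^ 'n) set"
  assumes "closed M" "M \<noteq> {}"
  shows "nearest_points infnorm M x \<noteq> {}"
proof -
  obtain z0 where z0: "z0 \<in> M" using assms by auto
  let ?r = "infnorm (x - z0)"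
  let ?B = "cbox (\<chi> j. x $ j - ?r) (\<chi> j. x $ j + ?r)"
  have ball: "z \<in> ?B" if "infnorm (x - z) \<le> ?r" for z
  proof -
    have "\<bar>x $ j - z $ j\<bar> \<le> ?r" for j
      using component_le_infnorm_cart[of "x - z" j] that by simp
    then show ?thesis unfolding mem_box_cart by (auto simp: abs_le_iff algebra_simps)
  qed
  have "compact (M \<inter> ?B)" using assms by (intro closed_Int_compact) auto
  moreover have "M \<inter> ?B \<noteq> {}" using z0 ball[of z0] by auto
  moreover have "continuous_on (M \<inter> ?B) (\<lambda>z. infnorm (x - z))"
    by (intro continuous_intros continuous_on_infnorm)
  ultimately obtain y where y: "y \<in> M \<inter> ?B" "\<forall>z \<in> M \<inter> ?B. infnorm (x - y) \<le> infnorm (x - z)"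
    using continuous_attains_inf by blast
  have "infnorm (x - y) \<le> ?r" using y(2) z0 ball[of z0] by blast
  then have "infnorm (x - y) \<le> infnorm (x - z)" if "z \<in> M" for z
    using y(2) ball[of z] that by (cases "infnorm (x - z) \<le> ?r") auto
  then show ?thesis using y(1) nearest_points_infnorm_iff by blast
qed

text \<open>
  If \<open>M\<close> misses the part within distance \<open>e\<close> of the cone at
  \<open>y\<close> containing \<open>z\<close>, then a ball of radius \<open>e / 2\<close>
  inscribed in this part has \<open>y\<close> as a nearest point of \<open>M\<close> to its
  centre. Blowing it up from \<open>y\<close> must keep it free of points of \<open>M\<close>, yet
  a large enough copy swallows \<open>z\<close>.
\<close>

lemma strict_sun_imp_approachable:
  fixes M :: "(real ^ 'n) set"
  assumes "strict_sun infnorm M"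
  shows "approachable M"
  unfolding approachable_def
proof (intro ballI allI impI, rule ccontr)
  fix y z :: "real ^ 'n" and e :: real
  assume y: "y \<in> M" and z: "z \<in> M" and e: "e > 0"
  assume none: "\<not> (\<exists>w\<in>M. \<forall>j. \<bar>w $ j - y $ j\<bar> < e \<and>
      (z $ j \<noteq> y $ j \<longrightarrow> (w $ j - y $ j) * (z $ j - y $ j) > 0))"
  define r where "r = e / 2"
  define d :: "real ^ 'n" where "d = (\<chi> j. r * sgn (z $ j - y $ j))"
  have r: "r > 0" "2 * r = e" using e by (auto simp: r_def)
  have "z \<noteq> y" using none y e by force
  then obtain i where i: "z $ i \<noteq> y $ i" by (auto simp: vec_eq_iff)
  have far: "r \<le> infnorm (y + d - w)" if w: "w \<in> M" for w
  proof (rule ccontr)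
    assume "\<not> r \<le> infnorm (y + d - w)"
    then have "\<bar>y $ j + d $ j - w $ j\<bar> < r" for j
      by (auto simp: infnorm_less_iff_cart not_le)
    moreover have "d $ j = r * sgn (z $ j - y $ j)" for j by (simp add: d_def)
    ultimately have *: "\<bar>(w $ j - y $ j) - r * sgn (z $ j - y $ j)\<bar> < r" for j
      by (smt (verit))
    have "\<bar>w $ j - y $ j\<bar> < e \<and> (z $ j \<noteq> y $ j \<longrightarrow> (w $ j - y $ j) * (z $ j - y $ j) > 0)" for j
      using *[of j] r by (cases "z $ j" "y $ j" rule: linorder_cases)
        (auto simp: sgn_if mult_neg_neg)
    then show False using none w by blast
  qed
  have leval: "l * r \<le> infnorm (l *\<^sub>R d)" if "l > 0" for l
    using component_le_infnorm_cart[of "l *\<^sub>R d" i] i that r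
    by (auto simp: d_def abs_mult sgn_if split: if_splits)
  have val: "infnorm d \<le> r"
    using r unfolding infnorm_le_iff_cart by (auto simp: d_def abs_mult sgn_if)
  have "y + d \<notin> M" using far[of "y + d"] r by (auto simp: infnorm_0)
  moreover have "y \<in> nearest_points infnorm M (y + d)"
    using far val y by (auto simp: nearest_points_infnorm_iff intro: order_trans)
  ultimately have ray: "y \<in> nearest_points infnorm M (l *\<^sub>R (y + d) + (1 - l) *\<^sub>R y)" if "l > 0" for l
    using assms that unfolding strict_sun_def by blast
  \<comment> \<open>Any factor that makes the blown-up radius exceed the distance from \<open>y\<close> to \<open>z\<close> will do.\<close>
  define l where "l = (infnorm (z - y) + 1) / r"
  have l: "l > 0" "l * r = infnorm (z - y) + 1"
    using r infnorm_pos_le[of "z - y"] by (auto simp: l_def)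
  have eq: "l *\<^sub>R (y + d) + (1 - l) *\<^sub>R y = y + l *\<^sub>R d" by (simp add: algebra_simps)
  have "l * r \<le> infnorm (y + l *\<^sub>R d - z)"
    using ray[OF l(1)] leval[OF l(1)] z unfolding eq nearest_points_infnorm_iff by force
  moreover have "infnorm (y + l *\<^sub>R d - z) < l * r"
    unfolding infnorm_less_iff_cart
  proof
    fix j
    have "\<bar>z $ j - y $ j\<bar> < l * r"
      using component_le_infnorm_cart[of "z - y" j] l by simp
    then show "\<bar>(y + l *\<^sub>R d - z) $ j\<bar> < l * r"
      by (cases "z $ j" "y $ j" rule: linorder_cases) (auto simp: d_def sgn_if abs_less_iff)
  qed
  ultimately show False by simp
qed

text \<open>
  Suppose that some point \<open>z\<close> of \<open>M\<close> is closer than \<open>y\<close> to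
  a point of the ray from \<open>y\<close> through \<open>x\<close>. Then \<open>z\<close> lies on
  the same side of \<open>y\<close> as \<open>x\<close> in every coordinate in which \<open>x -
  y\<close> attains its norm. Approaching \<open>y\<close> from there gives points of
  \<open>M\<close> slightly closer to \<open>x\<close> in these coordinates, and the remaining
  coordinates have room to spare.
\<close>

lemma approachable_imp_strict_sun:
  fixes M :: "(real ^ 'n) set"
  assumes M: "approachable M" and "closed M" "M \<noteq> {}"
  shows "strict_sun infnorm M"
  unfolding strict_sun_def
proof (intro allI impI conjI ballI)
  fix x show "nearest_points infnorm M x \<noteq> {}"
    using nearest_points_infnorm_nonempty assms by blast
next
  fix x y :: "real ^ 'n" and l :: real
  assume x: "x \<notin> M" and y: "y \<in> nearest_points infnorm M x" and l: "0 < l"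
  define r where "r = infnorm (x - y)"
  have yM: "y \<in> M" and near: "\<And>w. w \<in> M \<Longrightarrow> r \<le> infnorm (x - w)"
    using y by (auto simp: nearest_points_infnorm_iff r_def)
  have r: "r > 0" using x yM by (auto simp: r_def infnorm_pos_lt)
  have comp: "\<bar>x $ j - y $ j\<bar> \<le> r" for j
    using component_le_infnorm_cart[of "x - y" j] by (simp add: r_def)
  show "y \<in> nearest_points infnorm M (l *\<^sub>R x + (1 - l) *\<^sub>R y)"
  proof (rule ccontr)
    assume "\<not> ?thesis"
    moreover have "infnorm (l *\<^sub>R x + (1 - l) *\<^sub>R y - y) = l * r"
    proof -
      have "l *\<^sub>R x + (1 - l) *\<^sub>R y - y = l *\<^sub>R (x - y)" by (simp add: algebra_simps)
      then show ?thesis using l by (simp add: infnorm_mul r_def)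
    qed
    ultimately obtain z where z: "z \<in> M" "infnorm (l *\<^sub>R x + (1 - l) *\<^sub>R y - z) < l * r"
      using yM by (force simp: nearest_points_infnorm_iff)
    have zj: "\<bar>l * (x $ j - y $ j) - (z $ j - y $ j)\<bar> < l * r" for j
      using z(2) unfolding infnorm_less_iff_cart by (simp add: algebra_simps)
    \<comment> \<open>The room left by the coordinates in which \<open>x - y\<close> does not attain its norm.\<close>
    define e where "e = Min (insert r ((\<lambda>j. r - \<bar>x $ j - y $ j\<bar>) ` {j. \<bar>x $ j - y $ j\<bar> < r}))"
    have e: "e > 0" "e \<le> r" "\<And>j. \<bar>x $ j - y $ j\<bar> < r \<Longrightarrow> e \<le> r - \<bar>x $ j - y $ j\<bar>"
      using r unfolding e_def by auto
    obtain w where w: "w \<in> M" "\<And>j. \<bar>w $ j - y $ j\<bar> < e"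
      "\<And>j. z $ j \<noteq> y $ j \<Longrightarrow> (w $ j - y $ j) * (z $ j - y $ j) > 0"
      using approachableD[OF M yM z(1) e(1)] by metis
    have "\<bar>x $ j - w $ j\<bar> < r" for j
    proof (cases "\<bar>x $ j - y $ j\<bar> < r")
      case True
      then show ?thesis using e(3)[OF True] w(2)[of j] by linarith
    next
      case False
      then consider "x $ j - y $ j = r" | "x $ j - y $ j = - r" using comp[of j] by linarith
      then show ?thesis
      proof cases
        case 1
        then have "z $ j - y $ j > 0" using zj[of j] l by auto
        then have "w $ j - y $ j > 0" using w(3)[of j] by (auto simp: zero_less_mult_iff)
        then show ?thesis using 1 w(2)[of j] e(2) by linarith
      next
        case 2
        then have "z $ j - y $ j < 0" using zj[of j] l by auto
        then have "w $ j - y $ j < 0" using w(3)[of j] by (auto simp: zero_less_mult_iff)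
        then show ?thesis using 2 w(2)[of j] e(2) by linarith
      qed
    qed
    then have "infnorm (x - w) < r" by (simp add: infnorm_less_iff_cart)
    then show False using near[OF w(1)] by simp
  qed
qed

section \<open>From strict $\ell^1$-convexity to approachability\<close>

lemma path_leaves_start_strictly:
  fixes k :: "real \<Rightarrow> real ^ 'n"
  assumes k: "path k" "path_image k \<subseteq> M" "pathstart k = y" "pathfinish k = z"
    and mono: "\<And>j. z $ j \<noteq> y $ j \<Longrightarrow>
      strict_mono_on {0..1} (\<lambda>t. k t $ j) \<or> strict_antimono_on {0..1} (\<lambda>t. k t $ j)"
    and e: "e > 0"
  shows "\<exists>w\<in>M. \<forall>j. \<bar>w $ j - y $ j\<bar> < e \<and>
    (z $ j \<noteq> y $ j \<longrightarrow> (w $ j - y $ j) * (z $ j - y $ j) > 0)"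
proof -
  have k01: "k 0 = y" "k 1 = z" using k by (auto simp: pathstart_def pathfinish_def)
  have "continuous_on {0..1} k" using k by (simp add: path_def)
  then obtain d where d: "d > 0" "\<And>t. t \<in> {0..1} \<Longrightarrow> dist t 0 < d \<Longrightarrow> dist (k t) (k 0) < e"
    using e unfolding continuous_on_iff by (metis atLeastAtMost_iff order_refl zero_le_one)
  define t where "t = min d 1 / 2"
  have t: "0 < t" "t < 1" "dist t 0 < d" using d by (auto simp: t_def)
  have "k t \<in> M" using k t by (auto simp: path_image_def)
  moreover have "\<bar>k t $ j - y $ j\<bar> < e" for j
    using component_le_norm_cart[of "k t - y" j] d(2)[of t] t
    by (simp add: k01 dist_norm)
  moreover have "(k t $ j - y $ j) * (z $ j - y $ j) > 0" if "z $ j \<noteq> y $ j" for j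
    using mono[OF that]
  proof
    assume "strict_mono_on {0..1} (\<lambda>t. k t $ j)"
    then have "k 0 $ j < k t $ j" "k t $ j < k 1 $ j"
      using t by (auto simp: monotone_on_def)
    then show ?thesis by (simp add: k01 zero_less_mult_iff)
  next
    assume "strict_antimono_on {0..1} (\<lambda>t. k t $ j)"
    then have "k 0 $ j > k t $ j" "k t $ j > k 1 $ j"
      using t by (auto simp: monotone_on_def)
    then show ?thesis by (simp add: k01 zero_less_mult_iff)
  qed
  ultimately show ?thesis by blast
qed

text \<open>
  The good case of approachability: \<open>y\<close> and \<open>z\<close> differ wherever points
  of \<open>M\<close> can differ, and the initial part of a strictly monotonic curve from
  \<open>y\<close> to \<open>z\<close> does the job.
\<close>

lemma strictly_l1_convex_step:
  assumes M: "strictly_l1_convex M" and y: "y \<in> M" and z: "z \<in> M"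
    and ne: "\<And>j. j \<notin> eqc M \<Longrightarrow> y $ j \<noteq> z $ j" and e: "e > 0"
  shows "\<exists>w\<in>M. \<forall>j. \<bar>w $ j - y $ j\<bar> < e \<and>
    (z $ j \<noteq> y $ j \<longrightarrow> (w $ j - y $ j) * (z $ j - y $ j) > 0)"
proof -
  obtain k where k: "path k" "path_image k \<subseteq> M" "pathstart k = y" "pathfinish k = z"
    "\<And>j. j \<notin> eqc M \<Longrightarrow>
      strict_mono_on {0..1} (\<lambda>t. k t $ j) \<or> strict_antimono_on {0..1} (\<lambda>t. k t $ j)"
    using M y z ne unfolding strictly_l1_convex_def by meson
  have "j \<notin> eqc M" if "z $ j \<noteq> y $ j" for j using y z that by (auto simp: eqc_def)
  then show ?thesis using path_leaves_start_strictly[OF k(1-4) _ e] k(5) by blast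
qed

lemma same_side:
  fixes u v y z :: real
  assumes "\<bar>u - v\<bar> < \<bar>v - y\<bar>" "(v - y) * (z - y) > 0"
  shows "(u - y) * (z - y) > 0"
  using assms by (auto simp: zero_less_mult_iff)

text \<open>
  The only obstruction to approachability. Let \<open>z\<close> lie off \<open>y\<close> in two
  coordinates \<open>a\<close>, \<open>b\<close> only, and let the part of \<open>M\<close> in the
  quadrant of \<open>z\<close> (\<open>R a\<close> and \<open>R b\<close>) stay in the plane
  \<open>v $ c = y $ c\<close>, although \<open>M\<close> has a point \<open>w\<close> outside the
  plane. A strictly monotonic curve between a point inside the plane and one outside leaves the
  plane at once; whenever this is impossible, the two points have to share one of the coordinates
  \<open>a\<close>, \<open>b\<close>. Applied to enough pairs of points, this puts everything
  outside the plane on the line through \<open>(y $ a, z $ b)\<close> parallel to the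
  \<open>c\<close>-axis, and everything inside on the two lines in the plane parallel to the axes
  that pass through the same centre. Which of the two conceivable centres occurs depends on the
  coordinate in which \<open>w\<close> is on the wrong side of \<open>y\<close>; here it is
  \<open>a\<close>.
\<close>

lemma strictly_l1_convex_one_sided_cross:
  fixes M :: "(real ^ 3) set" and a b c :: 3
  defines "R \<equiv> \<lambda>y z j v. ((v::real^3) $ j - y $ j) * ((z::real^3) $ j - y $ j) > 0"
  assumes M: "strictly_l1_convex M"
    and abc: "UNIV = {a, b, c}" "a \<noteq> b" "a \<noteq> c" "b \<noteq> c"
    and y: "y \<in> M" and z: "z \<in> M" and w: "w \<in> M"
    and ne: "z $ a \<noteq> y $ a" "z $ b \<noteq> y $ b" "z $ c = y $ c"
    and wc: "w $ c \<noteq> y $ c" and wa: "\<not> R y z a w"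
    and flat: "\<And>v. v \<in> M \<Longrightarrow> R y z a v \<Longrightarrow> R y z b v \<Longrightarrow> v $ c = y $ c"
  shows "R3_cross M"
proof -
  have all: "(\<forall>j. P j) \<longleftrightarrow> P a \<and> P b \<and> P c" for P :: "3 \<Rightarrow> bool"
    using abc(1) by (metis UNIV_I empty_iff insert_iff)
  have "j \<notin> eqc M" for j
    using all[of "\<lambda>j. j \<notin> eqc M"] y z w ne wc unfolding eqc_def by fastforce
  then have eqc: "eqc M = {}" by auto
  have step: "\<exists>u\<in>M. \<forall>j. \<bar>u $ j - v $ j\<bar> < e \<and> (v' $ j - v $ j) * (u $ j - v $ j) > 0"
    if "v \<in> M" "v' \<in> M" "v $ a \<noteq> v' $ a" "v $ b \<noteq> v' $ b" "v $ c \<noteq> v' $ c" "e > 0" for v v' e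
  proof -
    have d: "\<forall>j. v $ j \<noteq> v' $ j" using that all[of "\<lambda>j. v $ j \<noteq> v' $ j"] by simp
    show ?thesis
      using strictly_l1_convex_step[OF M that(1,2) _ that(6)] d by (metis mult.commute)
  qed
  \<comment> \<open>Otherwise a strict curve from \<open>v\<close> would lead out of the plane while still in the quadrant.\<close>
  have G: "v' $ a = v $ a \<or> v' $ b = v $ b"
    if v: "v \<in> M" "R y z a v" "R y z b v" and v': "v' \<in> M" "v' $ c \<noteq> y $ c" for v v'
  proof (rule ccontr)
    assume n: "\<not> ?thesis"
    define e where "e = min \<bar>v $ a - y $ a\<bar> \<bar>v $ b - y $ b\<bar>"
    have d: "v $ a \<noteq> v' $ a" "v $ b \<noteq> v' $ b" "v $ c \<noteq> v' $ c" "e > 0"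
      using n v v'(2) flat[OF v] by (auto simp: e_def R_def)
    from step[OF v(1) v'(1) d] obtain u where u: "u \<in> M" "\<And>j. \<bar>u $ j - v $ j\<bar> < e"
        "\<And>j. (v' $ j - v $ j) * (u $ j - v $ j) > 0" by blast
    have "R y z a u" "R y z b u"
      using u(2)[of a] u(2)[of b] v same_side[of "u $ a" "v $ a" "y $ a" "z $ a"]
        same_side[of "u $ b" "v $ b" "y $ b" "z $ b"] by (auto simp: e_def R_def)
    then show False using flat[OF u(1)] u(3)[of c] flat[OF v] by simp
  qed
  have Rz: "R y z a z" "R y z b z"
    using ne by (auto simp: R_def zero_less_mult_iff)
  have wb: "w $ b = v $ b" if "v \<in> M" "R y z a v" "R y z b v" for v
    using G[OF that w wc] wa that(2) by (auto simp: R_def)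
  \<comment> \<open>A curve from \<open>y\<close> to \<open>z\<close> enters the quadrant before its end; take the point where the smaller of
    the normalised displacements from \<open>y\<close> in the coordinates \<open>a\<close> and \<open>b\<close> is one half. The \<open>b\<close>-coordinate is
    that of \<open>z\<close> throughout the quadrant, so it is the \<open>a\<close>-coordinate that has advanced half way only.\<close>
  obtain v where v: "v \<in> M" "R y z a v" "R y z b v" "v $ a \<noteq> z $ a"
  proof -
    obtain k where k: "path k" "path_image k \<subseteq> M" "pathstart k = y" "pathfinish k = z"
      using M y z unfolding strictly_l1_convex_def l1_convex_def by meson
    have k01: "k 0 = y" "k 1 = z" using k by (auto simp: pathstart_def pathfinish_def)
    define g where "g = (\<lambda>j t. (k t $ j - y $ j) / (z $ j - y $ j))"
    have "continuous_on {0..1} k" using k by (simp add: path_def)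
    then have "continuous_on {0..1} (\<lambda>t. min (g a t) (g b t))"
      unfolding g_def using ne by (intro continuous_intros) auto
    then obtain t where t: "0 \<le> t" "t \<le> 1" "min (g a t) (g b t) = 1 / 2"
      using IVT'[of "\<lambda>t. min (g a t) (g b t)" 0 "1/2" 1] ne by (auto simp: g_def k01)
    have kt: "k t \<in> M" using k t by (auto simp: path_image_def)
    have pos: "(p - q) * (r - q) > 0" if "(p - q) / (r - q) > 0" for p q r :: real
      using that by (simp add: zero_less_divide_iff zero_less_mult_iff)
    have "g a t > 0" "g b t > 0" using t(3) by auto
    then have R: "R y z a (k t)" "R y z b (k t)"
      unfolding R_def g_def by (auto intro: pos)
    have "k t $ b = z $ b" using wb[OF kt R] wb[OF z Rz] by simp
    then have "g b t = 1" using ne by (simp add: g_def)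
    then have "g a t = 1 / 2" using t(3) by linarith
    then have "k t $ a \<noteq> z $ a" using ne by (auto simp: g_def)
    then show ?thesis using that kt R by blast
  qed
  \<comment> \<open>No point outside the plane shares its \<open>a\<close>-coordinate with both \<open>v\<close> and \<open>z\<close>.\<close>
  have Hb: "v' $ b = z $ b" if "v' \<in> M" "v' $ c \<noteq> y $ c" for v'
    using G[OF v(1-3) that] G[OF z Rz that] v(4) wb[OF v(1-3)] wb[OF z Rz] by auto
  \<comment> \<open>Otherwise a strict curve from \<open>y\<close> leaves the plane with a \<open>b\<close>-coordinate close to \<open>y $ b\<close>,
    in conflict with \<open>Hb\<close>.\<close>
  have Ha: "v' $ a = y $ a" if v': "v' \<in> M" "v' $ c \<noteq> y $ c" for v'
  proof (rule ccontr)
    assume n: "v' $ a \<noteq> y $ a"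
    have d: "y $ a \<noteq> v' $ a" "y $ b \<noteq> v' $ b" "y $ c \<noteq> v' $ c" "\<bar>z $ b - y $ b\<bar> > 0"
      using n Hb[OF v'] v'(2) ne by auto
    from step[OF y v'(1) d] obtain u where u: "u \<in> M" "\<bar>u $ b - y $ b\<bar> < \<bar>z $ b - y $ b\<bar>"
        "(v' $ c - y $ c) * (u $ c - y $ c) > 0" by blast
    have "u $ c \<noteq> y $ c" using u(3) by force
    from Hb[OF u(1) this] show False using u(2) by simp
  qed
  have planar: "v' $ a = y $ a \<or> v' $ b = z $ b" if v': "v' \<in> M" "v' $ c = y $ c" for v'
  proof (rule ccontr)
    assume n: "\<not> ?thesis"
    have d: "v' $ a \<noteq> w $ a" "v' $ b \<noteq> w $ b" "v' $ c \<noteq> w $ c" "\<bar>v' $ a - y $ a\<bar> > 0"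
      using n Ha[OF w wc] Hb[OF w wc] wc v'(2) by auto
    from step[OF v'(1) w d] obtain u where u: "u \<in> M" "\<bar>u $ a - v' $ a\<bar> < \<bar>v' $ a - y $ a\<bar>"
        "(w $ c - v' $ c) * (u $ c - v' $ c) > 0" by blast
    have "u $ c \<noteq> y $ c" using u(3) v'(2) by force
    from Ha[OF u(1) this] show False using u(2) by simp
  qed
  define p :: "real ^ 3" where "p = (\<chi> j. if j = b then z $ b else y $ j)"
  have p: "p $ a = y $ a" "p $ b = z $ b" "p $ c = y $ c" using abc by (auto simp: p_def)
  have two: "v' \<in> main_cross p" if "i \<noteq> j" "p $ i = v' $ i" "p $ j = v' $ j" for i j v'
  proof -
    have "{i, j} \<subseteq> eqc {p, v'}" using that by (auto simp: eqc_def)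
    then have "card {i, j} \<le> card (eqc {p, v'})" by (intro card_mono) auto
    then show ?thesis using that(1) by (simp add: main_cross_def)
  qed
  have "v' \<in> main_cross p" if v': "v' \<in> M" for v'
  proof (cases "v' $ c = y $ c")
    case True
    then show ?thesis using planar[OF v' True] two[of a c v'] two[of b c v'] p abc by auto
  next
    case False
    then show ?thesis using Ha[OF v' False] Hb[OF v' False] two[of a b v'] p abc by auto
  qed
  then show ?thesis using eqc by (auto simp: R3_cross_def)
qed

text \<open>
  A monotonic curve between points that differ in a single coordinate runs along the segment
  joining them.
\<close>

lemma l1_convex_axis_step:
  assumes M: "l1_convex M" and y: "y \<in> M" and z: "z \<in> M"
    and i: "z $ i \<noteq> y $ i" and eq: "\<And>j. j \<noteq> i \<Longrightarrow> z $ j = y $ j" and e: "e > 0"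
  shows "\<exists>w\<in>M. \<forall>j. \<bar>w $ j - y $ j\<bar> < e \<and>
    (z $ j \<noteq> y $ j \<longrightarrow> (w $ j - y $ j) * (z $ j - y $ j) > 0)"
proof -
  obtain k where k: "path k" "path_image k \<subseteq> M" "pathstart k = y" "pathfinish k = z"
    "\<And>j. mono_on {0..1} (\<lambda>t. k t $ j) \<or> antimono_on {0..1} (\<lambda>t. k t $ j)"
    using M y z unfolding l1_convex_def by meson
  have k01: "k 0 = y" "k 1 = z" using k by (auto simp: pathstart_def pathfinish_def)
  define d where "d = \<bar>z $ i - y $ i\<bar>"
  define q where "q = min 1 (e / d) / 2"
  have d: "d > 0" using i by (simp add: d_def)
  have q: "0 < q" "q < 1" "q * d < e" using d e by (auto simp: q_def min_def field_simps)
  have "continuous_on {0..1} k" using k by (simp add: path_def)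
  then have "continuous_on {0..1} (\<lambda>t. (k t $ i - y $ i) / (z $ i - y $ i))"
    using i by (intro continuous_intros) auto
  then obtain t where t: "0 \<le> t" "t \<le> 1" "(k t $ i - y $ i) / (z $ i - y $ i) = q"
    using IVT'[of "\<lambda>t. (k t $ i - y $ i) / (z $ i - y $ i)" 0 q 1] i q by (auto simp: k01)
  have kt: "k t \<in> M" using k t by (auto simp: path_image_def)
  have ki: "k t $ i - y $ i = q * (z $ i - y $ i)" using t(3) i by (simp add: field_simps)
  have kj: "k t $ j = y $ j" if "j \<noteq> i" for j
    using k(5)[of j]
  proof
    assume "mono_on {0..1} (\<lambda>t. k t $ j)"
    then have "k 0 $ j \<le> k t $ j" "k t $ j \<le> k 1 $ j" using t by (auto simp: monotone_on_def)
    then show ?thesis using eq[OF that] by (simp add: k01)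
  next
    assume "antimono_on {0..1} (\<lambda>t. k t $ j)"
    then have "k 0 $ j \<ge> k t $ j" "k t $ j \<ge> k 1 $ j" using t by (auto simp: monotone_on_def)
    then show ?thesis using eq[OF that] by (simp add: k01)
  qed
  have "\<bar>k t $ j - y $ j\<bar> < e \<and> (z $ j \<noteq> y $ j \<longrightarrow> (k t $ j - y $ j) * (z $ j - y $ j) > 0)" for j
  proof (cases "j = i")
    case True
    have "\<bar>k t $ i - y $ i\<bar> < e" using q by (simp add: ki abs_mult d_def)
    moreover have "(k t $ i - y $ i) * (z $ i - y $ i) > 0"
      using mult_pos_pos[OF q(1), of "(z $ i - y $ i) * (z $ i - y $ i)"] i
      unfolding ki mult.assoc by (metis right_minus_eq not_real_square_gt_zero)
    ultimately show ?thesis using True by simp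
  next
    case False
    then show ?thesis using kj eq e by simp
  qed
  then show ?thesis using kt by blast
qed

text \<open>
  Either the quadrant of \<open>z\<close> contains a point that differs from \<open>y\<close> in
  the third coordinate as well, which can replace \<open>z\<close> and admits a strict curve, or
  \<open>M\<close> is a cross.
\<close>

lemma strictly_l1_convex_plane_step:
  fixes M :: "(real ^ 3) set" and a b c :: 3
  assumes M: "strictly_l1_convex M" and nc: "\<not> R3_cross M"
    and abc: "UNIV = {a, b, c}" "a \<noteq> b" "a \<noteq> c" "b \<noteq> c"
    and y: "y \<in> M" and z: "z \<in> M"
    and ne: "z $ a \<noteq> y $ a" "z $ b \<noteq> y $ b" "z $ c = y $ c"
    and c: "c \<notin> eqc M" and e: "e > 0"
  shows "\<exists>w\<in>M. \<forall>j. \<bar>w $ j - y $ j\<bar> < e \<and>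
    (z $ j \<noteq> y $ j \<longrightarrow> (w $ j - y $ j) * (z $ j - y $ j) > 0)"
proof -
  have all: "(\<forall>j. P j) \<longleftrightarrow> P a \<and> P b \<and> P c" for P :: "3 \<Rightarrow> bool"
    using abc(1) by (metis UNIV_I empty_iff insert_iff)
  obtain v v' where "v \<in> M" "v' \<in> M" "v $ c \<noteq> v' $ c" using c by (auto simp: eqc_def)
  then obtain w where w: "w \<in> M" "w $ c \<noteq> y $ c" by metis
  let ?R = "\<lambda>j v. (v $ j - y $ j) * (z $ j - y $ j) > 0"
  show ?thesis
  proof (cases "\<exists>v\<in>M. ?R a v \<and> ?R b v \<and> v $ c \<noteq> y $ c")
    case True
    then obtain v where v: "v \<in> M" "?R a v" "?R b v" "v $ c \<noteq> y $ c" by blast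
    have "\<forall>j. y $ j \<noteq> v $ j" unfolding all using v by auto
    then obtain u where u: "u \<in> M" "\<And>j. \<bar>u $ j - y $ j\<bar> < e"
      "\<And>j. (u $ j - y $ j) * (v $ j - y $ j) > 0"
      using strictly_l1_convex_step[OF M y v(1) _ e] by metis
    have "?R a u" "?R b u" using u(3)[of a] u(3)[of b] v by (auto simp: zero_less_mult_iff)
    then have "\<forall>j. z $ j \<noteq> y $ j \<longrightarrow> ?R j u" unfolding all using ne by auto
    then show ?thesis using u by blast
  next
    case False
    then have flat: "\<And>v. v \<in> M \<Longrightarrow> ?R a v \<Longrightarrow> ?R b v \<Longrightarrow> v $ c = y $ c" by blast
    consider "\<not> ?R a w" | "\<not> ?R b w" using flat[OF w(1)] w(2) by blast
    then have "R3_cross M"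
    proof cases
      case 1
      then show ?thesis
        using strictly_l1_convex_one_sided_cross[OF M abc y z w(1) ne w(2) _ flat] by blast
    next
      case 2
      have bac: "UNIV = {b, a, c}" "b \<noteq> a" using abc by auto
      show ?thesis
        using strictly_l1_convex_one_sided_cross[OF M bac abc(4,3) y z w(1) ne(2,1,3) w(2) 2] flat
        by blast
    qed
    then show ?thesis using nc by simp
  qed
qed

lemma three_indices:
  fixes c :: 3
  obtains a b where "UNIV = {a, b, c}" "a \<noteq> b" "a \<noteq> c" "b \<noteq> c"
proof -
  have "finite (UNIV - {c})" "card (UNIV - {c}) = 2" by simp_all
  then obtain a b where "UNIV - {c} = {a, b}" "a \<noteq> b" by (meson card_2_iff)
  then have "UNIV = {a, b, c}" "a \<noteq> b" "a \<noteq> c" "b \<noteq> c" by blast+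
  then show ?thesis using that by blast
qed

lemma strictly_l1_convex_imp_approachable:
  fixes M :: "(real ^ 3) set"
  assumes M: "strictly_l1_convex M" and nc: "\<not> R3_cross M"
  shows "approachable M"
  unfolding approachable_def
proof (intro ballI allI impI)
  fix y z :: "real ^ 3" and e :: real
  assume y: "y \<in> M" and z: "z \<in> M" and e: "e > 0"
  let ?goal = "\<exists>w\<in>M. \<forall>j. \<bar>w $ j - y $ j\<bar> < e \<and>
    (z $ j \<noteq> y $ j \<longrightarrow> (w $ j - y $ j) * (z $ j - y $ j) > 0)"
  have l1: "l1_convex M" using M by (simp add: strictly_l1_convex_def)
  show ?goal
  proof (cases "\<forall>j. j \<notin> eqc M \<longrightarrow> y $ j \<noteq> z $ j")
    case True
    then show ?thesis using strictly_l1_convex_step[OF M y z _ e] by blast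
  next
    case False
    then obtain c where c: "c \<notin> eqc M" "z $ c = y $ c" by metis
    obtain a b where abc: "UNIV = {a, b, c}" "a \<noteq> b" "a \<noteq> c" "b \<noteq> c"
      by (rule three_indices)
    have all: "(\<forall>j. P j) \<longleftrightarrow> P a \<and> P b \<and> P c" for P :: "3 \<Rightarrow> bool"
      using abc(1) by (metis UNIV_I empty_iff insert_iff)
    consider "z $ a = y $ a" "z $ b = y $ b" | "z $ a \<noteq> y $ a" "z $ b = y $ b"
      | "z $ a = y $ a" "z $ b \<noteq> y $ b" | "z $ a \<noteq> y $ a" "z $ b \<noteq> y $ b" by blast
    then show ?thesis
    proof cases
      case 1
      then have "\<forall>j. z $ j = y $ j" unfolding all using c by simp
      then show ?thesis using y e by (intro bexI[of _ y]) auto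
    next
      case 2
      then have "\<forall>j. j \<noteq> a \<longrightarrow> z $ j = y $ j" unfolding all using c by simp
      then show ?thesis using l1_convex_axis_step[OF l1 y z 2(1) _ e] by blast
    next
      case 3
      then have "\<forall>j. j \<noteq> b \<longrightarrow> z $ j = y $ j" unfolding all using c by simp
      then show ?thesis using l1_convex_axis_step[OF l1 y z 3(2) _ e] by blast
    next
      case 4
      then show ?thesis
        using strictly_l1_convex_plane_step[OF M nc abc y z 4 c(2,1) e] by blast
    qed
  qed
qed

section \<open>Crosses are not approachable\<close>

text \<open>
  From a point on one arm of a cross, the points of another arm cannot be approached: to do so,
  one would have to leave the first arm.
\<close>

lemma approachable_not_R3_cross:
  fixes M :: "(real ^ 3) set"
  assumes M: "approachable M"
  shows "\<not> R3_cross M"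
proof
  assume "R3_cross M"
  then obtain p where p: "M \<subseteq> main_cross p" and eqc: "eqc M = {}"
    by (auto simp: R3_cross_def)
  have one: "u $ j = p $ j" if u: "u \<in> M" "u $ i \<noteq> p $ i" "j \<noteq> i" for u i j
  proof (rule ccontr)
    assume "u $ j \<noteq> p $ j"
    then have "eqc {p, u} \<subseteq> UNIV - {i, j}" using u(2) by (auto simp: eqc_def)
    then have "card (eqc {p, u}) \<le> card (UNIV - {i, j})" by (intro card_mono) auto
    also have "\<dots> = 1" using u(3) by (simp add: card_Diff_subset)
    finally show False using p u(1) by (auto simp: main_cross_def)
  qed
  have axis: "\<exists>u\<in>M. u $ i \<noteq> p $ i" for i
  proof -
    have "i \<notin> eqc M" using eqc by simp
    then show ?thesis unfolding eqc_def by auto metis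
  qed
  obtain x where x: "x \<in> M" "x $ 1 \<noteq> p $ 1" using axis by blast
  obtain y where y: "y \<in> M" "y $ 2 \<noteq> p $ 2" using axis by blast
  have "x $ 2 = p $ 2" "y $ 1 = p $ 1" using one[OF x, of 2] one[OF y, of 1] by auto
  obtain w where w: "w \<in> M" "\<And>j. \<bar>w $ j - x $ j\<bar> < \<bar>x $ 1 - p $ 1\<bar>"
      "\<And>j. y $ j \<noteq> x $ j \<Longrightarrow> (w $ j - x $ j) * (y $ j - x $ j) > 0"
    using approachableD[OF M x(1) y(1), of "\<bar>x $ 1 - p $ 1\<bar>"] x(2) by auto
  have "w $ 1 \<noteq> p $ 1" using w(2)[of 1] by auto
  moreover have "w $ 2 \<noteq> p $ 2" using w(3)[of 2] y(2) \<open>x $ 2 = p $ 2\<close> by auto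
  ultimately show False using one[of w 1 2] w(1) by auto
qed

section \<open>Intermediate levels in approachable sets\<close>

text \<open>
  The Minkowski functional of the interval \<open>{a..b}\<close> with respect to its interior
  point \<open>y\<close>.
\<close>

definition interval_gauge :: "real \<Rightarrow> real \<Rightarrow> real \<Rightarrow> real \<Rightarrow> real" where
  "interval_gauge a y b t = max ((y - t) / (y - a)) ((t - y) / (b - y))"

context
  fixes a y b :: real
  assumes ay: "a < y" and yb: "y < b"
begin

lemma interval_gauge_center: "interval_gauge a y b y = 0"
  by (simp add: interval_gauge_def)

lemma interval_gauge_pos: "t \<noteq> y \<Longrightarrow> interval_gauge a y b t > 0"
  using ay yb by (auto simp: interval_gauge_def less_max_iff_disj zero_less_divide_iff)

lemma interval_gauge_nonneg: "interval_gauge a y b t \<ge> 0"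
  using interval_gauge_pos[of t] interval_gauge_center by (cases "t = y") auto

lemma interval_gauge_le_1_iff: "interval_gauge a y b t \<le> 1 \<longleftrightarrow> a \<le> t \<and> t \<le> b"
  using ay yb by (auto simp: interval_gauge_def divide_le_eq)

lemma interval_gauge_lt:
  assumes "\<bar>t - y\<bar> < r * min (y - a) (b - y)" "r > 0"
  shows "interval_gauge a y b t < r"
proof -
  have "r * min (y - a) (b - y) \<le> r * (y - a)" "r * min (y - a) (b - y) \<le> r * (b - y)"
    using assms(2) by (auto intro!: mult_left_mono)
  then show ?thesis using assms(1) ay yb by (auto simp: interval_gauge_def divide_less_eq)
qed

lemma interval_gauge_closer:
  assumes "\<bar>t' - t\<bar> < \<bar>y - t\<bar>" "(t' - t) * (y - t) > 0"
  shows "interval_gauge a y b t' < interval_gauge a y b t"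
proof (cases "t < y")
  case True
  then have "t < t'" "t' < y" using assms by (auto simp: zero_less_mult_iff)
  then have "(t' - y) / (b - y) < (y - t') / (y - a)" "(y - t') / (y - a) < (y - t) / (y - a)"
    using ay yb by (auto simp: divide_strict_right_mono intro: order_less_trans[of _ 0]
        simp: divide_less_0_iff)
  then show ?thesis by (auto simp: interval_gauge_def)
next
  case False
  then have "t' < t" "y < t'" using assms by (auto simp: zero_less_mult_iff)
  then have "(y - t') / (y - a) < (t' - y) / (b - y)" "(t' - y) / (b - y) < (t - y) / (b - y)"
    using ay yb by (auto simp: divide_strict_right_mono intro: order_less_trans[of _ 0]
        simp: divide_less_0_iff)
  then show ?thesis by (auto simp: interval_gauge_def)
qed

end

lemma finite_positive_lower_bound:
  fixes g :: "'n::finite \<Rightarrow> real"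
  assumes "\<And>j. g j > 0"
  obtains e where "e > 0" "\<And>j. e \<le> g j"
proof
  show "Min (range g) > 0" using assms by simp
  show "Min (range g) \<le> g j" for j by simp
qed

text \<open>
  Of the points of \<open>M\<close> in the box that are not beyond the level \<open>s\<close>,
  take one, \<open>v\<close>, that minimises the gauge \<open>\<Phi>\<close> of the box about
  \<open>y\<close> in the coordinates other than \<open>i\<close>. If \<open>v\<close> had not
  reached the level, a step from \<open>v\<close> towards \<open>y\<close> would decrease
  \<open>\<Phi>\<close>: it shrinks every coordinate that contributes to the maximum, and a
  coordinate in which \<open>v\<close> agrees with \<open>y\<close>, over which the step has no
  control, does not contribute as long as \<open>\<Phi> v > 0\<close>. To exclude \<open>\<Phi> v
  = 0\<close>, that is, \<open>v\<close> on the line through \<open>y\<close> in direction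
  \<open>i\<close>, start above the last point of \<open>M\<close> on this line. The step above
  that point may leave the line to either side, which is why \<open>y\<close> has to be interior
  to the box.
\<close>

lemma approachable_level_slack:
  fixes M :: "(real ^ 'n) set"
  assumes M: "approachable M" "closed M" and x: "x \<in> M" and y: "y \<in> M"
    and s: "(s - x $ i) * (y $ i - s) > 0"
    and ab: "\<And>j. j \<noteq> i \<Longrightarrow> a j < y $ j \<and> y $ j < b j"
    and xab: "\<And>j. j \<noteq> i \<Longrightarrow> a j \<le> x $ j \<and> x $ j \<le> b j"
  shows "\<exists>v\<in>M. v $ i = s \<and> (\<forall>j. j \<noteq> i \<longrightarrow> a j \<le> v $ j \<and> v $ j \<le> b j)"
proof -
  \<comment> \<open>The sign \<open>\<sigma>\<close> makes \<open>\<sigma> * v $ i\<close> increase on the way from \<open>x\<close> to \<open>y\<close>; \<open>A w\<close> is the part of \<open>M\<close> in the box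
    between the level of \<open>w\<close> and the level \<open>s\<close>.\<close>
  define \<sigma> where "\<sigma> = sgn (y $ i - x $ i)"
  have \<sigma>: "\<sigma> = 1 \<or> \<sigma> = - 1" "\<sigma> * x $ i < \<sigma> * s" "\<sigma> * s < \<sigma> * y $ i"
    using s by (auto simp: \<sigma>_def sgn_if zero_less_mult_iff)
  define A where "A = (\<lambda>w. {v \<in> M. (\<forall>j. j \<noteq> i \<longrightarrow> a j \<le> v $ j \<and> v $ j \<le> b j) \<and>
    \<sigma> * w $ i \<le> \<sigma> * v $ i \<and> \<sigma> * v $ i \<le> \<sigma> * s})"
  have compact_A: "compact (A w)" for w
  proof -
    let ?lo = "\<chi> j. if j = i then min (w $ i) s else a j"
    let ?hi = "\<chi> j. if j = i then max (w $ i) s else b j"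
    have "A w \<subseteq> cbox ?lo ?hi"
      using \<sigma>(1) by (auto simp: A_def mem_box_cart)
    moreover have "closed (A w)"
    proof -
      have "A w = M \<inter> {v. (\<forall>j. j \<noteq> i \<longrightarrow> a j \<le> v $ j \<and> v $ j \<le> b j) \<and>
          \<sigma> * w $ i \<le> \<sigma> * v $ i \<and> \<sigma> * v $ i \<le> \<sigma> * s}" by (auto simp: A_def)
      also have "closed \<dots>"
        using M(2) by (intro closed_Int closed_Collect_conj closed_Collect_all closed_Collect_imp
            closed_Collect_le open_Collect_const continuous_intros) auto
      finally show ?thesis .
    qed
    ultimately show ?thesis using bounded_subset[OF bounded_cbox] compact_eq_bounded_closed by blast
  qed
  have step: "\<exists>u'\<in>M. (\<forall>j. \<bar>u' $ j - u $ j\<bar> < e) \<and> \<sigma> * u $ i < \<sigma> * u' $ i \<and> \<sigma> * u' $ i < \<sigma> * u $ i + e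
      \<and> (\<forall>j. y $ j \<noteq> u $ j \<longrightarrow> (u' $ j - u $ j) * (y $ j - u $ j) > 0)"
    if u: "u \<in> M" "\<sigma> * u $ i < \<sigma> * s" and e: "e > 0" for u e
  proof -
    obtain u' where u': "u' \<in> M" "\<And>j. \<bar>u' $ j - u $ j\<bar> < e"
      "\<And>j. y $ j \<noteq> u $ j \<Longrightarrow> (u' $ j - u $ j) * (y $ j - u $ j) > 0"
      using approachableD[OF M(1) u(1) y e] by metis
    have "\<sigma> * u $ i < \<sigma> * y $ i" using u(2) \<sigma>(3) by linarith
    then have "\<sigma> * u $ i < \<sigma> * u' $ i"
      using u'(3)[of i] \<sigma>(1) by (auto simp: zero_less_mult_iff)
    moreover have "\<sigma> * u' $ i < \<sigma> * u $ i + e"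
      using u'(2)[of i] \<sigma>(1) by auto
    ultimately show ?thesis using u' by blast
  qed
  have goal: ?thesis if "v \<in> A w" "\<not> \<sigma> * v $ i < \<sigma> * s" for v w
    using that \<sigma>(1) by (intro bexI[of _ v]) (auto simp: A_def)
  show ?thesis
  proof (rule ccontr)
    assume contra: "\<not> ?thesis"
    then have below: "\<sigma> * v $ i < \<sigma> * s" if "v \<in> A w" for v w using goal that by blast
    have xA: "x \<in> A x" using x xab \<sigma>(2) by (auto simp: A_def)
    \<comment> \<open>A starting point above which \<open>M\<close> has left the line through \<open>y\<close> in direction \<open>i\<close>.\<close>
    obtain w where w: "w \<in> A x" "\<And>v. v \<in> A w \<Longrightarrow> \<exists>j. j \<noteq> i \<and> v $ j \<noteq> y $ j"
    proof (cases "\<exists>v\<in>A x. \<forall>j. j \<noteq> i \<longrightarrow> v $ j = y $ j")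
      case False
      then show ?thesis using that[of x] xA by blast
    next
      case True
      define Z where "Z = A x \<inter> {v. \<forall>j. j \<noteq> i \<longrightarrow> v $ j = y $ j}"
      have "closed {v :: real ^ 'n. \<forall>j. j \<noteq> i \<longrightarrow> v $ j = y $ j}"
        by (intro closed_Collect_all closed_Collect_imp closed_Collect_eq
            open_Collect_const continuous_intros)
      then have "compact Z" unfolding Z_def using compact_A by (intro compact_Int_closed)
      moreover have "Z \<noteq> {}" using True by (auto simp: Z_def)
      moreover have "continuous_on Z (\<lambda>v. \<sigma> * v $ i)" by (intro continuous_intros)
      ultimately obtain u where u: "u \<in> Z" "\<And>v. v \<in> Z \<Longrightarrow> \<sigma> * v $ i \<le> \<sigma> * u $ i"
        using continuous_attains_sup by metis
      have uA: "u \<in> A x" "u \<in> M" "\<And>j. j \<noteq> i \<Longrightarrow> u $ j = y $ j" using u(1) by (auto simp: Z_def A_def)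
      define g where "g = (\<lambda>j. if j = i then \<sigma> * s - \<sigma> * u $ i else min (y $ j - a j) (b j - y $ j))"
      have "g j > 0" for j using below[OF uA(1)] ab[of j] by (auto simp: g_def)
      then obtain e where e: "e > 0" "\<And>j. e \<le> g j" using finite_positive_lower_bound by blast
      obtain u' where u': "u' \<in> M" "\<And>j. \<bar>u' $ j - u $ j\<bar> < e" "\<sigma> * u $ i < \<sigma> * u' $ i"
          "\<sigma> * u' $ i < \<sigma> * u $ i + e"
        using step[OF uA(2) below[OF uA(1)] e(1)] by blast
      have "a j \<le> u' $ j \<and> u' $ j \<le> b j" if "j \<noteq> i" for j
        using u'(2)[of j] uA(3)[OF that] e(2)[of j] that by (auto simp: g_def)
      moreover have "\<sigma> * u' $ i \<le> \<sigma> * s" using e(2)[of i] u'(4) by (simp add: g_def)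
      moreover have "\<sigma> * x $ i \<le> \<sigma> * u' $ i" using uA(1) u'(3) by (simp add: A_def)
      ultimately have "u' \<in> A x" using u'(1) by (simp add: A_def)
      moreover have "\<exists>j. j \<noteq> i \<and> v $ j \<noteq> y $ j" if v: "v \<in> A u'" for v
      proof (rule ccontr)
        assume "\<not> ?thesis"
        then have "v \<in> Z" using v \<open>\<sigma> * x $ i \<le> \<sigma> * u' $ i\<close> by (auto simp: Z_def A_def)
        then show False using u(2) u'(3) v by (force simp: A_def)
      qed
      ultimately show ?thesis using that by blast
    qed
    let ?\<phi> = "\<lambda>j. interval_gauge (a j) (y $ j) (b j)"
    define \<Phi> where "\<Phi> = (\<lambda>v :: real ^ 'n. infnorm (\<chi> j. if j = i then 0 else ?\<phi> j (v $ j)))"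
    have nonneg: "?\<phi> j t \<ge> 0" if "j \<noteq> i" for j t
      using interval_gauge_nonneg ab[OF that] by blast
    have \<Phi>_ge: "?\<phi> j (v $ j) \<le> \<Phi> v" if "j \<noteq> i" for j v
      using component_le_infnorm_cart[of "\<chi> j. if j = i then 0 else ?\<phi> j (v $ j)" j] that nonneg
      by (simp add: \<Phi>_def)
    have "continuous_on (A w) (\<lambda>v. if j = i then 0 else ?\<phi> j (v $ j))" for j
      using ab[of j] unfolding interval_gauge_def
      by (cases "j = i") (auto intro!: continuous_intros)
    then have "continuous_on (A w) \<Phi>"
      unfolding \<Phi>_def by (intro continuous_on_infnorm continuous_on_vec_lambda)
    moreover have wA: "w \<in> A w" using w(1) by (simp add: A_def)
    ultimately obtain v where v: "v \<in> A w" "\<And>v'. v' \<in> A w \<Longrightarrow> \<Phi> v \<le> \<Phi> v'"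
      using continuous_attains_inf[OF compact_A, of w \<Phi>] by blast
    have vM: "v \<in> M" using v(1) by (simp add: A_def)
    have \<Phi>_pos: "\<Phi> v > 0"
    proof -
      obtain j where j: "j \<noteq> i" "v $ j \<noteq> y $ j" using w(2)[OF v(1)] by blast
      then have "?\<phi> j (v $ j) > 0" using interval_gauge_pos ab by blast
      then show ?thesis using \<Phi>_ge[OF j(1), of v] by linarith
    qed
    \<comment> \<open>The step must not cross the level \<open>s\<close>, must not overshoot \<open>y\<close> in the coordinates where \<open>v\<close> differs
      from \<open>y\<close>, and must keep the gauge of the other coordinates below \<open>\<Phi> v\<close>.\<close>
    define g where "g = (\<lambda>j. if j = i then \<sigma> * s - \<sigma> * v $ i
      else if v $ j \<noteq> y $ j then \<bar>y $ j - v $ j\<bar> else \<Phi> v * min (y $ j - a j) (b j - y $ j))"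
    have "g j > 0" for j using below[OF v(1)] ab[of j] \<Phi>_pos by (auto simp: g_def)
    then obtain e where e: "e > 0" "\<And>j. e \<le> g j" using finite_positive_lower_bound by blast
    obtain u where u: "u \<in> M" "\<And>j. \<bar>u $ j - v $ j\<bar> < e" "\<sigma> * v $ i < \<sigma> * u $ i"
        "\<sigma> * u $ i < \<sigma> * v $ i + e"
        "\<And>j. y $ j \<noteq> v $ j \<Longrightarrow> (u $ j - v $ j) * (y $ j - v $ j) > 0"
      using step[OF vM below[OF v(1)] e(1)] by blast
    have lt: "?\<phi> j (u $ j) < \<Phi> v" if j: "j \<noteq> i" for j
    proof (cases "v $ j = y $ j")
      case True
      then show ?thesis
        using interval_gauge_lt[of "a j" "y $ j" "b j" "u $ j" "\<Phi> v"] ab[OF j] \<Phi>_pos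
          u(2)[of j] e(2)[of j] j by (simp add: g_def)
    next
      case False
      then have "?\<phi> j (u $ j) < ?\<phi> j (v $ j)"
        using interval_gauge_closer[of "a j" "y $ j" "b j" "u $ j" "v $ j"] ab[OF j]
          u(2)[of j] e(2)[of j] u(5)[of j] j by (simp add: g_def)
      then show ?thesis using \<Phi>_ge[OF j, of v] by linarith
    qed
    have "\<Phi> v \<le> 1"
    proof -
      have "?\<phi> j (v $ j) \<le> 1" if "j \<noteq> i" for j
        using interval_gauge_le_1_iff ab[OF that] v(1) that by (auto simp: A_def)
      then show ?thesis unfolding \<Phi>_def infnorm_le_iff_cart using nonneg by auto
    qed
    then have "?\<phi> j (u $ j) \<le> 1" if "j \<noteq> i" for j using lt[OF that] by linarith
    then have "a j \<le> u $ j \<and> u $ j \<le> b j" if "j \<noteq> i" for j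
      using interval_gauge_le_1_iff ab[OF that] that by blast
    moreover have "\<sigma> * u $ i \<le> \<sigma> * s" using u(4) e(2)[of i] by (simp add: g_def)
    moreover have "\<sigma> * w $ i \<le> \<sigma> * u $ i" using u(3) v(1) by (simp add: A_def)
    ultimately have "u \<in> A w" using u(1) by (simp add: A_def)
    moreover have "\<Phi> u < \<Phi> v"
      using lt nonneg \<Phi>_pos by (auto simp: \<Phi>_def infnorm_less_iff_cart)
    ultimately show False using v(2) by force
  qed
qed

text \<open>
  The points between \<open>x\<close> and \<open>y\<close> in the sense of the metric
  \<open>l1_dist\<close>: the coordinate box spanned by \<open>x\<close> and \<open>y\<close>.
\<close>

definition l1_interval :: "real ^ 'n \<Rightarrow> real ^ 'n \<Rightarrow> (real ^ 'n) set" where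
  "l1_interval x y = {z. \<forall>j. min (x $ j) (y $ j) \<le> z $ j \<and> z $ j \<le> max (x $ j) (y $ j)}"

definition l1_dist :: "real ^ 'n \<Rightarrow> real ^ 'n \<Rightarrow> real" where
  "l1_dist x y = (\<Sum>j\<in>UNIV. \<bar>x $ j - y $ j\<bar>)"

lemma l1_intervalD:
  "z \<in> l1_interval x y \<Longrightarrow> min (x $ j) (y $ j) \<le> z $ j"
  "z \<in> l1_interval x y \<Longrightarrow> z $ j \<le> max (x $ j) (y $ j)"
  by (auto simp: l1_interval_def)

text \<open>
  The slack around the box spanned by \<open>x\<close> and \<open>y\<close> can be removed because
  \<open>M\<close> is closed: otherwise the points of \<open>M\<close> at level \<open>s\<close>
  would have a positive distance from the box.
\<close>

lemma approachable_level:
  fixes M :: "(real ^ 'n) set"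
  assumes M: "approachable M" "closed M" and x: "x \<in> M" and y: "y \<in> M"
    and s: "(s - x $ i) * (y $ i - s) > 0"
  shows "\<exists>v\<in>M \<inter> l1_interval x y. v $ i = s"
proof (rule ccontr)
  assume none: "\<not> ?thesis"
  define G where "G = M \<inter> {v. v $ i = s} \<inter>
    cbox (\<chi> j. min (x $ j) (y $ j) - 1) (\<chi> j. max (x $ j) (y $ j) + 1)"
  have "closed {v :: real ^ 'n. v $ i = s}" by (intro closed_Collect_eq continuous_intros)
  then have "compact G" unfolding G_def using M(2) by (intro closed_Int_compact closed_Int) auto
  moreover have "l1_interval x y = cbox (\<chi> j. min (x $ j) (y $ j)) (\<chi> j. max (x $ j) (y $ j))"
    by (auto simp: l1_interval_def mem_box_cart)
  then have "closed (l1_interval x y)" by (simp add: closed_cbox)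
  moreover have "G \<inter> l1_interval x y = {}" using none by (auto simp: G_def)
  ultimately obtain d where d: "d > 0" "\<And>u v. u \<in> G \<Longrightarrow> v \<in> l1_interval x y \<Longrightarrow> d \<le> dist u v"
    using separate_compact_closed by metis
  define \<eta> where "\<eta> = min 1 (d / (2 * real CARD('n)))"
  have \<eta>: "0 < \<eta>" "\<eta> \<le> 1" "real CARD('n) * \<eta> < d"
  proof -
    have "real CARD('n) * \<eta> \<le> real CARD('n) * (d / (2 * real CARD('n)))"
      by (intro mult_left_mono) (auto simp: \<eta>_def)
    also have "\<dots> = d / 2" by simp
    finally show "real CARD('n) * \<eta> < d" using d(1) by linarith
  qed (use d(1) in \<open>auto simp: \<eta>_def\<close>)
  obtain v where v: "v \<in> M" "v $ i = s"
    "\<And>j. j \<noteq> i \<Longrightarrow> min (x $ j) (y $ j) - \<eta> \<le> v $ j \<and> v $ j \<le> max (x $ j) (y $ j) + \<eta>"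
    using approachable_level_slack[OF M x y s, of "\<lambda>j. min (x $ j) (y $ j) - \<eta>"
        "\<lambda>j. max (x $ j) (y $ j) + \<eta>"] \<eta>(1) by (force simp: min_def max_def)
  have vi: "min (x $ i) (y $ i) \<le> s" "s \<le> max (x $ i) (y $ i)"
    using s by (auto simp: zero_less_mult_iff)
  have box: "min (x $ j) (y $ j) - \<eta> \<le> v $ j \<and> v $ j \<le> max (x $ j) (y $ j) + \<eta>" for j
    using v(2) v(3)[of j] vi \<eta>(1) by (cases "j = i") auto
  have "min (x $ j) (y $ j) - 1 \<le> v $ j \<and> v $ j \<le> max (x $ j) (y $ j) + 1" for j
    using box[of j] \<eta>(2) by linarith
  then have "v \<in> G" using v(1,2) by (simp add: G_def mem_box_cart)
  \<comment> \<open>The point of the box nearest to \<open>v\<close>.\<close>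
  moreover define c :: "real ^ 'n" where
    "c = (\<chi> j. max (min (x $ j) (y $ j)) (min (v $ j) (max (x $ j) (y $ j))))"
  moreover have "c \<in> l1_interval x y" by (auto simp: c_def l1_interval_def)
  ultimately have "d \<le> dist v c" using d(2) by blast
  also have "\<dots> \<le> (\<Sum>j\<in>UNIV. \<bar>(v - c) $ j\<bar>)" unfolding dist_norm by (rule norm_le_l1_cart)
  also have "\<dots> \<le> real CARD('n) * \<eta>"
  proof (rule sum_bounded_above)
    fix j
    show "\<bar>(v - c) $ j\<bar> \<le> \<eta>" using box[of j] \<eta>(1) by (auto simp: c_def min_def max_def)
  qed
  finally show False using \<eta>(3) by simp
qed

section \<open>Midpoints in approachable sets\<close>

lemma l1_interval_additive:
  assumes "z \<in> l1_interval x y"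
  shows "l1_dist x z + l1_dist z y = l1_dist x y"
proof -
  have "\<bar>x $ j - z $ j\<bar> + \<bar>z $ j - y $ j\<bar> = \<bar>x $ j - y $ j\<bar>" for j
    using l1_intervalD[OF assms, of j] by linarith
  then show ?thesis by (simp add: l1_dist_def sum.distrib[symmetric])
qed

text \<open>
  A point that splits the longest edge of the box at a ratio bounded away from 0 and 1 splits the
  \<open>l1_dist\<close> in the same manner, with a constant that depends on the dimension only.
\<close>

lemma l1_dist_contraction:
  fixes x y z :: "real ^ 'n"
  defines "c \<equiv> 1 - 1 / (4 * real CARD('n))"
  assumes z: "z \<in> l1_interval x y" and i: "\<And>j. \<bar>x $ j - y $ j\<bar> \<le> \<bar>x $ i - y $ i\<bar>"
    and far: "\<bar>x $ i - y $ i\<bar> \<le> 4 * \<bar>x $ i - z $ i\<bar>" "\<bar>x $ i - y $ i\<bar> \<le> 4 * \<bar>z $ i - y $ i\<bar>"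
  shows "l1_dist x z \<le> c * l1_dist x y" "l1_dist z y \<le> c * l1_dist x y"
proof -
  define r where "r = l1_dist x y / (4 * real CARD('n))"
  have "l1_dist x y \<le> real CARD('n) * \<bar>x $ i - y $ i\<bar>"
    unfolding l1_dist_def by (rule sum_bounded_above) (rule i)
  then have r: "4 * r \<le> \<bar>x $ i - y $ i\<bar>" by (simp add: r_def field_simps)
  have ge: "\<bar>x $ i - z $ i\<bar> \<le> l1_dist x z" "\<bar>z $ i - y $ i\<bar> \<le> l1_dist z y"
    unfolding l1_dist_def by (rule member_le_sum; simp)+
  have "c * l1_dist x y = l1_dist x y - r" by (simp add: c_def r_def algebra_simps)
  moreover have "r \<le> l1_dist x z" using r far(1) ge(1) by (smt (verit))
  moreover have "r \<le> l1_dist z y" using r far(2) ge(2) by (smt (verit))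
  ultimately show "l1_dist x z \<le> c * l1_dist x y" "l1_dist z y \<le> c * l1_dist x y"
    using l1_interval_additive[OF z] by simp_all
qed

lemma widest_coordinate:
  fixes x y :: "real ^ 'n"
  obtains i where "\<And>j. \<bar>x $ j - y $ j\<bar> \<le> \<bar>x $ i - y $ i\<bar>"
proof -
  have "Max (range (\<lambda>j. \<bar>x $ j - y $ j\<bar>)) \<in> range (\<lambda>j. \<bar>x $ j - y $ j\<bar>)"
    by (intro Max_in) auto
  then obtain i where i: "Max (range (\<lambda>j. \<bar>x $ j - y $ j\<bar>)) = \<bar>x $ i - y $ i\<bar>" by blast
  have "\<bar>x $ j - y $ j\<bar> \<le> \<bar>x $ i - y $ i\<bar>" for j
    unfolding i[symmetric] by (intro Max_ge) auto
  then show ?thesis using that by blast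
qed

lemma approachable_midpoint:
  fixes M :: "(real ^ 'n) set"
  assumes M: "approachable M" "closed M" and x: "x \<in> M" and y: "y \<in> M"
  defines "c \<equiv> 1 - 1 / (4 * real CARD('n))"
  shows "\<exists>z\<in>M. z \<in> l1_interval x y \<and> l1_dist x z \<le> c * l1_dist x y \<and> l1_dist z y \<le> c * l1_dist x y"
proof -
  obtain i where i: "\<And>j. \<bar>x $ j - y $ j\<bar> \<le> \<bar>x $ i - y $ i\<bar>" by (rule widest_coordinate) blast
  show ?thesis
  proof (cases "x $ i = y $ i")
    case True
    then have "x = y" using i by (simp add: vec_eq_iff)
    then show ?thesis using x by (intro bexI[of _ x]) (auto simp: l1_interval_def l1_dist_def)
  next
    case False
    define s where "s = (x $ i + y $ i) / 2"
    have "s - x $ i = (y $ i - x $ i) / 2" "y $ i - s = (y $ i - x $ i) / 2"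
      by (auto simp: s_def field_simps)
    then have "(s - x $ i) * (y $ i - s) > 0" using False by (auto simp: zero_less_mult_iff)
    then obtain z where z: "z \<in> M" "z \<in> l1_interval x y" "z $ i = s"
      using approachable_level[OF M x y] by blast
    have mid: "x $ i - z $ i = (x $ i - y $ i) / 2" "z $ i - y $ i = (x $ i - y $ i) / 2"
      unfolding z(3) s_def by (simp_all add: field_simps)
    have "\<bar>x $ i - y $ i\<bar> \<le> 4 * \<bar>x $ i - z $ i\<bar>" "\<bar>x $ i - y $ i\<bar> \<le> 4 * \<bar>z $ i - y $ i\<bar>"
      unfolding mid by simp_all
    then show ?thesis using l1_dist_contraction[OF z(2) i] z unfolding c_def by blast
  qed
qed

text \<open>
  Before the box is split, its two corners are moved a little towards each other, to
  \<open>p\<close> and \<open>q\<close>. Everything between \<open>p\<close> and \<open>q\<close>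
  is then strictly between \<open>x\<close> and \<open>y\<close> in the coordinates from
  \<open>S\<close>. This is where it matters that \<open>x\<close> and \<open>y\<close> differ in
  all coordinates that are not constant on \<open>M\<close>, since the moves are uncontrolled in
  coordinates that \<open>x\<close> and \<open>y\<close> share.
\<close>

lemma approachable_strict_midpoint:
  fixes M :: "(real ^ 'n) set"
  assumes M: "approachable M" "closed M" and x: "x \<in> M" and y: "y \<in> M"
    and S: "\<And>j u v. j \<notin> S \<Longrightarrow> u \<in> M \<Longrightarrow> v \<in> M \<Longrightarrow> u $ j = v $ j"
    and ne: "\<And>j. j \<in> S \<Longrightarrow> x $ j \<noteq> y $ j"
  defines "c \<equiv> 1 - 1 / (4 * real CARD('n))"
  shows "\<exists>z\<in>M. (\<forall>j\<in>S. x $ j \<noteq> z $ j \<and> z $ j \<noteq> y $ j) \<and>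
    z \<in> l1_interval x y \<and> l1_dist x z \<le> c * l1_dist x y \<and> l1_dist z y \<le> c * l1_dist x y"
proof -
  obtain i where i: "\<And>j. \<bar>x $ j - y $ j\<bar> \<le> \<bar>x $ i - y $ i\<bar>" by (rule widest_coordinate) blast
  show ?thesis
  proof (cases "x $ i = y $ i")
    case True
    then have "x = y" using i by (simp add: vec_eq_iff)
    then show ?thesis using x ne by (intro bexI[of _ x]) (auto simp: l1_interval_def l1_dist_def)
  next
    case False
    define g where "g = (\<lambda>j. if j \<in> S then \<bar>x $ j - y $ j\<bar> / 4 else 1)"
    have "g j > 0" for j using ne[of j] by (auto simp: g_def)
    then obtain e where e: "e > 0" "\<And>j. e \<le> g j" using finite_positive_lower_bound by blast
    have e4: "4 * e \<le> \<bar>x $ j - y $ j\<bar>" if "j \<in> S" for j using e(2)[of j] that by (simp add: g_def)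
    obtain p where p: "p \<in> M" "\<And>j. \<bar>p $ j - x $ j\<bar> < e"
      "\<And>j. y $ j \<noteq> x $ j \<Longrightarrow> (p $ j - x $ j) * (y $ j - x $ j) > 0"
      using approachableD[OF M(1) x y e(1)] by metis
    obtain q where q: "q \<in> M" "\<And>j. \<bar>q $ j - y $ j\<bar> < e"
      "\<And>j. x $ j \<noteq> y $ j \<Longrightarrow> (q $ j - y $ j) * (x $ j - y $ j) > 0"
      using approachableD[OF M(1) y x e(1)] by metis
    have ord: "x $ j < p $ j \<and> p $ j < q $ j \<and> q $ j < y $ j \<or>
        y $ j < q $ j \<and> q $ j < p $ j \<and> p $ j < x $ j" if j: "j \<in> S" for j
      using p(2)[of j] p(3)[of j] q(2)[of j] q(3)[of j] e4[OF j] ne[OF j] e(1)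
      by (cases "x $ j" "y $ j" rule: linorder_cases) (auto simp: zero_less_mult_iff)
    have iS: "i \<in> S" using False S x y by blast
    define s where "s = (p $ i + q $ i) / 2"
    have "s - p $ i = (q $ i - p $ i) / 2" "q $ i - s = (q $ i - p $ i) / 2"
      by (auto simp: s_def field_simps)
    then have "(s - p $ i) * (q $ i - s) > 0" using ord[OF iS] by (auto simp: zero_less_mult_iff)
    then obtain z where z: "z \<in> M" "z \<in> l1_interval p q" "z $ i = s"
      using approachable_level[OF M p(1) q(1)] by blast
    have zj: "x $ j < z $ j \<and> z $ j < y $ j \<or> y $ j < z $ j \<and> z $ j < x $ j" if j: "j \<in> S" for j
      using ord[OF j] l1_intervalD[OF z(2), of j] by linarith
    have zbox: "z \<in> l1_interval x y"
      unfolding l1_interval_def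
    proof (intro CollectI allI)
      fix j
      show "min (x $ j) (y $ j) \<le> z $ j \<and> z $ j \<le> max (x $ j) (y $ j)"
        using zj[of j] S[of j, OF _ z(1) x] S[of j, OF _ z(1) y] by (cases "j \<in> S") auto
    qed
    have mid: "2 * z $ i = p $ i + q $ i" using z(3) by (simp add: s_def)
    have "\<bar>x $ i - y $ i\<bar> \<le> 4 * \<bar>x $ i - z $ i\<bar>" "\<bar>x $ i - y $ i\<bar> \<le> 4 * \<bar>z $ i - y $ i\<bar>"
      using mid p(2)[of i] q(2)[of i] e4[OF iS] by (smt (verit))+
    then show ?thesis using l1_dist_contraction[OF zbox i] z zj zbox unfolding c_def
      by (intro bexI[of _ z]) force+
  qed
qed

section \<open>Monotonic curves by repeated bisection\<close>

text \<open>
  The curve obtained by inserting \<open>n\<close> generations of midpoints between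
  \<open>x\<close> and \<open>y\<close> and joining consecutive points by segments.
\<close>

primrec bisect :: "('a \<Rightarrow> 'a \<Rightarrow> 'a) \<Rightarrow> nat \<Rightarrow> 'a \<Rightarrow> 'a \<Rightarrow> real \<Rightarrow> 'a::real_normed_vector" where
  "bisect m 0 x y = linepath x y"
| "bisect m (Suc n) x y = bisect m n x (m x y) +++ bisect m n (m x y) y"

text \<open>
  Every coordinate is monotonic in the direction in which \<open>x\<close> and \<open>y\<close>
  are ordered. With the direction fixed in advance, the property passes to concatenations of
  curves through points between \<open>x\<close> and \<open>y\<close>, and to pointwise limits.
\<close>

definition directed :: "(real \<Rightarrow> real ^ 'n) \<Rightarrow> real ^ 'n \<Rightarrow> real ^ 'n \<Rightarrow> bool" where
  "directed k x y \<longleftrightarrow> (\<forall>j s t. 0 \<le> s \<longrightarrow> s \<le> t \<longrightarrow> t \<le> 1 \<longrightarrow>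
     (x $ j \<le> y $ j \<longrightarrow> k s $ j \<le> k t $ j) \<and> (y $ j \<le> x $ j \<longrightarrow> k t $ j \<le> k s $ j))"

lemma directed_mono:
  assumes "directed k x y" "0 \<le> s" "s \<le> t" "t \<le> 1"
  shows "x $ j \<le> y $ j \<Longrightarrow> k s $ j \<le> k t $ j" "y $ j \<le> x $ j \<Longrightarrow> k t $ j \<le> k s $ j"
  using assms by (auto simp: directed_def)

lemma directed_range:
  assumes "directed k x y" "k 0 = x" "k 1 = y" "0 \<le> t" "t \<le> 1"
  shows "k t \<in> l1_interval x y"
  unfolding l1_interval_def
proof (intro CollectI allI)
  fix j
  show "min (x $ j) (y $ j) \<le> k t $ j \<and> k t $ j \<le> max (x $ j) (y $ j)"
    using directed_mono[OF assms(1), of 0 t j] directed_mono[OF assms(1), of t 1 j] assms(2-5)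
    by (cases "x $ j \<le> y $ j") auto
qed

lemma directed_linepath: "directed (linepath x y) x y"
  unfolding directed_def
proof (intro allI impI)
  fix j and s t :: real
  assume st: "s \<le> t"
  have "linepath x y u $ j = x $ j + u * (y $ j - x $ j)" for u
    by (simp add: linepath_def algebra_simps)
  moreover have "s * d \<le> t * d" if "d \<ge> 0" for d using st that by (rule mult_right_mono)
  moreover have "t * d \<le> s * d" if "d \<le> 0" for d using st that by (rule mult_right_mono_neg)
  ultimately show "(x $ j \<le> y $ j \<longrightarrow> linepath x y s $ j \<le> linepath x y t $ j) \<and>
      (y $ j \<le> x $ j \<longrightarrow> linepath x y t $ j \<le> linepath x y s $ j)" by simp
qed

lemma directed_joinpaths:
  assumes k: "directed k x m" "k 0 = x" "k 1 = m" and l: "directed l m y" "l 0 = m" "l 1 = y"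
    and m: "m \<in> l1_interval x y"
  shows "directed (k +++ l) x y"
  unfolding directed_def
proof (intro allI impI)
  fix j and s t :: real
  assume st: "0 \<le> s" "s \<le> t" "t \<le> 1"
  let ?c = "k +++ l"
  have up: "x $ j \<le> m $ j" "m $ j \<le> y $ j" if "x $ j \<le> y $ j"
    using l1_intervalD[OF m, of j] that by auto
  have dn: "y $ j \<le> m $ j" "m $ j \<le> x $ j" if "y $ j \<le> x $ j"
    using l1_intervalD[OF m, of j] that by auto
  consider "t \<le> 1/2" | "s \<le> 1/2" "1/2 < t" | "1/2 < s" by linarith
  then show "(x $ j \<le> y $ j \<longrightarrow> ?c s $ j \<le> ?c t $ j) \<and> (y $ j \<le> x $ j \<longrightarrow> ?c t $ j \<le> ?c s $ j)"
  proof cases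
    case 1
    then show ?thesis
      using directed_mono[OF k(1), of "2 * s" "2 * t" j] st up dn by (auto simp: joinpaths_def)
  next
    case 2
    have "?c s = k (2 * s)" "?c t = l (2 * t - 1)" using 2 by (auto simp: joinpaths_def)
    moreover have "x $ j \<le> y $ j \<Longrightarrow> k (2 * s) $ j \<le> m $ j" "y $ j \<le> x $ j \<Longrightarrow> m $ j \<le> k (2 * s) $ j"
      using directed_mono[OF k(1), of "2 * s" 1 j] st 2 up dn k(3) by auto
    moreover have "x $ j \<le> y $ j \<Longrightarrow> m $ j \<le> l (2 * t - 1) $ j"
        "y $ j \<le> x $ j \<Longrightarrow> l (2 * t - 1) $ j \<le> m $ j"
      using directed_mono[OF l(1), of 0 "2 * t - 1" j] st 2 up dn l(2) by auto
    ultimately show ?thesis by auto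
  next
    case 3
    then show ?thesis
      using directed_mono[OF l(1), of "2 * s - 1" "2 * t - 1" j] st up dn
      by (auto simp: joinpaths_def)
  qed
qed

lemma dist_le_l1_dist_in_interval:
  assumes "u \<in> l1_interval x y" "v \<in> l1_interval x y"
  shows "dist u v \<le> l1_dist x y"
proof -
  have "\<bar>u $ j - v $ j\<bar> \<le> \<bar>x $ j - y $ j\<bar>" for j
    using l1_intervalD[OF assms(1), of j] l1_intervalD[OF assms(2), of j] by linarith
  then have "(\<Sum>j\<in>UNIV. \<bar>(u - v) $ j\<bar>) \<le> l1_dist x y"
    unfolding l1_dist_def by (intro sum_mono) simp
  then show ?thesis using norm_le_l1_cart[of "u - v"] by (simp add: dist_norm)
qed

text \<open>
  The curves \<open>bisect m n x y\<close> converge uniformly because each generation contracts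
  the \<open>l1_dist\<close> of consecutive points by the factor \<open>c\<close>. The limit runs
  in the closed set \<open>M\<close>, is directed like its approximations, and passes through all
  midpoints ever inserted; consecutive ones are related by \<open>Q\<close> and occur in every
  parameter interval. The relation \<open>Q\<close> serves to record strictness, and can be taken
  trivial if only monotonicity is wanted.
\<close>

lemma bisection_path:
  fixes M :: "(real ^ 'n) set" and Q :: "real ^ 'n \<Rightarrow> real ^ 'n \<Rightarrow> bool"
  assumes M: "closed M" and c: "0 \<le> c" "c < 1"
    and mid: "\<And>x y. x \<in> M \<Longrightarrow> y \<in> M \<Longrightarrow> Q x y \<Longrightarrow> \<exists>z\<in>M. Q x z \<and> Q z y \<and>
      z \<in> l1_interval x y \<and> l1_dist x z \<le> c * l1_dist x y \<and> l1_dist z y \<le> c * l1_dist x y"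
    and xy: "x \<in> M" "y \<in> M" "Q x y"
  obtains k where "path k" "path_image k \<subseteq> M" "pathstart k = x" "pathfinish k = y"
    "directed k x y"
    "\<And>s t. 0 \<le> s \<Longrightarrow> s < t \<Longrightarrow> t \<le> 1 \<Longrightarrow> \<exists>p q. s \<le> p \<and> p \<le> q \<and> q \<le> t \<and> Q (k p) (k q)"
proof -
  define R where "R = (\<lambda>x y. x \<in> M \<and> y \<in> M \<and> Q x y)"
  have "\<exists>z. R x y \<longrightarrow> R x z \<and> R z y \<and>
      z \<in> l1_interval x y \<and> l1_dist x z \<le> c * l1_dist x y \<and> l1_dist z y \<le> c * l1_dist x y" for x y
    using mid[of x y] by (auto simp: R_def)
  then obtain m where "\<And>x y. R x y \<Longrightarrow> R x (m x y) \<and> R (m x y) y \<and> m x y \<in> l1_interval x y \<and>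
      l1_dist x (m x y) \<le> c * l1_dist x y \<and> l1_dist (m x y) y \<le> c * l1_dist x y" by metis
  then have m: "R x (m x y)" "R (m x y) y" "m x y \<in> l1_interval x y"
      "l1_dist x (m x y) \<le> c * l1_dist x y" "l1_dist (m x y) y \<le> c * l1_dist x y"
    if "R x y" for x y using that by blast+
  let ?b = "bisect m"
  have b0: "?b n x y 0 = x" for n x y
  proof (induction n arbitrary: x y)
    case (Suc n) then show ?case by (simp add: joinpaths_def)
  qed (simp add: linepath_def)
  have b1: "?b n x y 1 = y" for n x y
  proof (induction n arbitrary: x y)
    case (Suc n) then show ?case by (simp add: joinpaths_def)
  qed (simp add: linepath_def)
  have path: "path (?b n x y)" for n x y
  proof (induction n arbitrary: x y)
    case (Suc n) then show ?case by (simp add: pathstart_def pathfinish_def b0 b1)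
  qed simp
  have dir: "directed (?b n x y) x y" if "R x y" for n x y
    using that
  proof (induction n arbitrary: x y)
    case 0 then show ?case by (simp add: directed_linepath)
  next
    case (Suc n)
    then show ?case using m[OF Suc.prems] by (auto intro!: directed_joinpaths simp: b0 b1)
  qed
  have range: "?b n x y t \<in> l1_interval x y" if "R x y" "0 \<le> t" "t \<le> 1" for n x y t
    using directed_range[OF dir b0 b1] that by blast
  have pow: "c ^ n * l1_dist x' y' \<le> c ^ Suc n * l1_dist x y"
    if "l1_dist x' y' \<le> c * l1_dist x y" for n x y x' y'
    using mult_left_mono[OF that, of "c ^ n"] c by (simp add: mult_ac)
  have close: "dist (?b n x y t) (?b (n + p) x y t) \<le> c ^ n * l1_dist x y"
    if "R x y" "0 \<le> t" "t \<le> 1" for n p x y t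
    using that
  proof (induction n arbitrary: x y t)
    case 0
    then show ?case using dist_le_l1_dist_in_interval range by (metis mult_1 power_0)
  next
    case (Suc n)
    note mm = m[OF Suc.prems(1)]
    show ?case
    proof (cases "t \<le> 1/2")
      case True
      have "dist (?b n x (m x y) (2 * t)) (?b (n + p) x (m x y) (2 * t)) \<le> c ^ n * l1_dist x (m x y)"
        using True Suc.prems by (intro Suc.IH mm) auto
      then show ?thesis using True pow[OF mm(4), of n] by (simp add: joinpaths_def)
    next
      case False
      have "dist (?b n (m x y) y (2 * t - 1)) (?b (n + p) (m x y) y (2 * t - 1)) \<le> c ^ n * l1_dist (m x y) y"
        using False Suc.prems by (intro Suc.IH mm) auto
      then show ?thesis using False pow[OF mm(5), of n] by (simp add: joinpaths_def)
    qed
  qed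
  have near: "\<exists>z\<in>M. dist (?b n x y t) z \<le> c ^ n * l1_dist x y"
    if "R x y" "0 \<le> t" "t \<le> 1" for n x y t
    using that
  proof (induction n arbitrary: x y t)
    case 0
    have "x \<in> l1_interval x y" by (auto simp: l1_interval_def)
    then show ?case
      using dist_le_l1_dist_in_interval[OF range[OF 0, of 0]] 0 by (intro bexI[of _ x]) (auto simp: R_def)
  next
    case (Suc n)
    note mm = m[OF Suc.prems(1)]
    show ?case
    proof (cases "t \<le> 1/2")
      case True
      have "\<exists>z\<in>M. dist (?b n x (m x y) (2 * t)) z \<le> c ^ n * l1_dist x (m x y)"
        using True Suc.prems by (intro Suc.IH mm) auto
      then show ?thesis
        using True pow[OF mm(4), of n] by (auto simp: joinpaths_def intro: order_trans)
    next
      case False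
      have "\<exists>z\<in>M. dist (?b n (m x y) y (2 * t - 1)) z \<le> c ^ n * l1_dist (m x y) y"
        using False Suc.prems by (intro Suc.IH mm) auto
      then show ?thesis
        using False pow[OF mm(5), of n] by (auto simp: joinpaths_def intro: order_trans)
    qed
  qed
  have c_lim: "(\<lambda>n. c ^ n * r) \<longlonglongrightarrow> 0" for r
    using tendsto_mult_right_zero[OF LIMSEQ_power_zero, of c r] c by (simp add: mult.commute)
  define k where "k = (\<lambda>x y t. lim (\<lambda>n. ?b n x y t))"
  have lim: "(\<lambda>n. ?b n x y t) \<longlonglongrightarrow> k x y t" if "R x y" "0 \<le> t" "t \<le> 1" for x y t
  proof -
    have "Cauchy (\<lambda>n. ?b n x y t)"
    proof (rule metric_CauchyI)
      fix e :: real assume "e > 0"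
      then obtain N where N: "\<And>n. n \<ge> N \<Longrightarrow> \<bar>c ^ n * l1_dist x y\<bar> < e / 2"
        using LIMSEQ_D[OF c_lim, of "e / 2" "l1_dist x y"] by auto
      have "dist (?b N x y t) (?b n x y t) < e / 2" if "n \<ge> N" for n
        using close[OF \<open>R x y\<close> \<open>0 \<le> t\<close> \<open>t \<le> 1\<close>, of N "n - N"] N[of N] that by auto
      then show "\<exists>N. \<forall>i\<ge>N. \<forall>j\<ge>N. dist (?b i x y t) (?b j x y t) < e"
        by (metis dist_triangle_half_r)
    qed
    then show ?thesis by (simp add: k_def Cauchy_convergent_iff convergent_LIMSEQ_iff)
  qed
  have k_close: "dist (?b n x y t) (k x y t) \<le> c ^ n * l1_dist x y"
    if "R x y" "0 \<le> t" "t \<le> 1" for n x y t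
  proof -
    have "(\<lambda>p. dist (?b n x y t) (?b (n + p) x y t)) \<longlonglongrightarrow> dist (?b n x y t) (k x y t)"
      using LIMSEQ_ignore_initial_segment[OF lim[OF that], of n]
      by (intro tendsto_dist tendsto_const) (simp add: add.commute)
    then show ?thesis using close[OF that] by (intro LIMSEQ_le_const2) auto
  qed
  have k_path: "path (k x y)" if "R x y" for x y
  proof -
    have "uniform_limit {0..1} (\<lambda>n. ?b n x y) (k x y) sequentially"
    proof (rule uniform_limitI)
      fix e :: real assume "e > 0"
      then have "\<forall>\<^sub>F n in sequentially. c ^ n * l1_dist x y < e"
        by (rule order_tendstoD[OF c_lim])
      then show "\<forall>\<^sub>F n in sequentially. \<forall>t\<in>{0..1}. dist (?b n x y t) (k x y t) < e"
      proof (rule eventually_mono, intro ballI)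
        fix n t assume "c ^ n * l1_dist x y < e" "t \<in> {0..1 :: real}"
        then show "dist (?b n x y t) (k x y t) < e"
          by (intro le_less_trans[OF k_close[OF that]]) auto
      qed
    qed
    then show ?thesis unfolding path_def
      using path by (intro uniform_limit_theorem[where F = sequentially]) (auto simp: path_def)
  qed
  have k0: "k x y 0 = x" and k1: "k x y 1 = y" for x y
    by (simp_all add: k_def b0 b1)
  have k_M: "k x y t \<in> M" if "R x y" "0 \<le> t" "t \<le> 1" for x y t
  proof -
    have "\<exists>z. z \<in> M \<and> dist (?b n x y t) z \<le> c ^ n * l1_dist x y" for n
      using near[OF that, of n] by blast
    then obtain z where z: "\<And>n. z n \<in> M" "\<And>n. dist (?b n x y t) (z n) \<le> c ^ n * l1_dist x y"
      by metis
    have "(\<lambda>n. dist (z n) (k x y t)) \<longlonglongrightarrow> 0"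
    proof (rule tendsto_sandwich[OF _ _ tendsto_const c_lim])
      have "dist (z n) (k x y t) \<le> c ^ n * (2 * l1_dist x y)" for n
        using dist_triangle3[of "z n" "k x y t" "?b n x y t"] z(2)[of n] k_close[OF that, of n] by simp
      then show "\<forall>\<^sub>F n in sequentially. dist (z n) (k x y t) \<le> c ^ n * (2 * l1_dist x y)" by simp
    qed simp
    then have "z \<longlonglongrightarrow> k x y t" by (rule iffD2[OF tendsto_dist_iff])
    then show ?thesis by (rule closed_sequentially[OF M z(1)])
  qed
  have k_dir: "directed (k x y) x y" if "R x y" for x y
    unfolding directed_def
  proof (intro allI impI)
    fix j and s t :: real
    assume st: "0 \<le> s" "s \<le> t" "t \<le> 1"
    have ls: "(\<lambda>n. ?b n x y s $ j) \<longlonglongrightarrow> k x y s $ j" and lt: "(\<lambda>n. ?b n x y t $ j) \<longlonglongrightarrow> k x y t $ j"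
      using st by (auto intro!: tendsto_vec_nth lim[OF that])
    have "x $ j \<le> y $ j \<Longrightarrow> ?b n x y s $ j \<le> ?b n x y t $ j"
        "y $ j \<le> x $ j \<Longrightarrow> ?b n x y t $ j \<le> ?b n x y s $ j" for n
      by (rule directed_mono[OF dir[OF that] st]; assumption)+
    then show "(x $ j \<le> y $ j \<longrightarrow> k x y s $ j \<le> k x y t $ j) \<and> (y $ j \<le> x $ j \<longrightarrow> k x y t $ j \<le> k x y s $ j)"
      using LIMSEQ_le[OF ls lt] LIMSEQ_le[OF lt ls] by blast
  qed
  \<comment> \<open>The limit inherits the recursion of its approximations, which gives its values at dyadic parameters.\<close>
  have k_join: "k x y t = (k x (m x y) +++ k (m x y) y) t" for x y t
  proof -
    have "lim (\<lambda>n. ?b n x y t) = lim (\<lambda>n. ?b (Suc n) x y t)"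
      unfolding lim_def by (simp only: filterlim_sequentially_Suc[of "\<lambda>n. ?b n x y t"])
    then show ?thesis by (simp add: k_def joinpaths_def)
  qed
  have dyadic: "R (k x y (real i / 2 ^ n)) (k x y (real (Suc i) / 2 ^ n))"
    if "R x y" "i < 2 ^ n" for x y i n
    using that
  proof (induction n arbitrary: x y i)
    case 0
    then show ?case by (simp add: k0 k1)
  next
    case (Suc n)
    note mm = m[OF Suc.prems(1)]
    have first: "k x y (real l / 2 ^ Suc n) = k x (m x y) (real l / 2 ^ n)" if "l \<le> 2 ^ n" for l
    proof -
      have "real l \<le> 2 ^ n" using that by (metis of_nat_le_iff of_nat_numeral of_nat_power)
      then show ?thesis by (simp add: k_join[of x y] joinpaths_def field_simps)
    qed
    have second: "k x y (real (2 ^ n + l) / 2 ^ Suc n) = k (m x y) y (real l / 2 ^ n)" for l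
    proof (cases "l = 0")
      case True
      then show ?thesis by (simp add: k_join[of x y] joinpaths_def k0 k1)
    next
      case False
      then have "real (2 ^ n + l) / 2 ^ Suc n > 1 / 2" by (simp add: field_simps)
      moreover have "2 * (real (2 ^ n + l) / 2 ^ Suc n) - 1 = real l / 2 ^ n"
        by (simp add: field_simps)
      ultimately show ?thesis by (simp add: k_join[of x y] joinpaths_def del: of_nat_add)
    qed
    show ?case
    proof (cases "i < 2 ^ n")
      case True
      then show ?thesis using Suc.IH[OF mm(1) True] first[of i] first[of "Suc i"] by simp
    next
      case False
      define l where "l = i - 2 ^ n"
      have i: "i = 2 ^ n + l" "Suc i = 2 ^ n + Suc l" "l < 2 ^ n"
        using False Suc.prems by (auto simp: l_def)
      show ?thesis unfolding i(2) unfolding i(1) second using Suc.IH[OF mm(2) i(3)] by blast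
    qed
  qed
  have Rxy: "R x y" using xy by (simp add: R_def)
  have "\<exists>p q. s \<le> p \<and> p \<le> q \<and> q \<le> t \<and> Q (k x y p) (k x y q)" if st: "0 \<le> s" "s < t" "t \<le> 1" for s t
  proof -
    \<comment> \<open>An interval longer than two dyadic steps contains a full one.\<close>
    obtain n where n: "2 / (t - s) < 2 ^ n" using real_arch_pow[of 2 "2 / (t - s)"] by auto
    then have n2: "2 < (t - s) * 2 ^ n" using st by (simp add: field_simps)
    define i where "i = nat \<lceil>s * 2 ^ n\<rceil>"
    have i: "s * 2 ^ n \<le> real i" "real i < s * 2 ^ n + 1"
      using st by (auto simp: i_def) linarith
    have it: "real (Suc i) \<le> t * 2 ^ n" using i(2) n2 by (simp add: algebra_simps)
    also have "\<dots> \<le> 2 ^ n" using st by (simp add: mult_le_cancel_right1)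
    finally have "i < 2 ^ n" by (metis Suc_le_eq of_nat_le_iff of_nat_numeral of_nat_power)
    then have "Q (k x y (real i / 2 ^ n)) (k x y (real (Suc i) / 2 ^ n))"
      using dyadic[OF Rxy] by (simp add: R_def)
    moreover have "s \<le> real i / 2 ^ n" "real i / 2 ^ n \<le> real (Suc i) / 2 ^ n"
        "real (Suc i) / 2 ^ n \<le> t"
      using i(1) it by (auto simp: field_simps)
    ultimately show ?thesis by blast
  qed
  moreover have "path_image (k x y) \<subseteq> M" using k_M[OF Rxy] by (auto simp: path_image_def)
  ultimately show ?thesis
    using that[of "k x y"] k_path[OF Rxy] k_dir[OF Rxy]
    by (simp add: pathstart_def pathfinish_def k0 k1)
qed

lemma directed_monotone:
  assumes "directed k x y"
  shows "mono_on {0..1} (\<lambda>t. k t $ j) \<or> antimono_on {0..1} (\<lambda>t. k t $ j)"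
  using directed_mono[OF assms, of _ _ j] by (cases "x $ j \<le> y $ j") (auto simp: monotone_on_def)

text \<open>
  A monotonic function that is not constant on any interval is strictly monotonic.
\<close>

lemma directed_strict_monotone:
  assumes k: "directed k x y"
    and ne: "\<And>s t. 0 \<le> s \<Longrightarrow> s < t \<Longrightarrow> t \<le> 1 \<Longrightarrow> \<exists>p q. s \<le> p \<and> p \<le> q \<and> q \<le> t \<and> k p $ j \<noteq> k q $ j"
  shows "strict_mono_on {0..1} (\<lambda>t. k t $ j) \<or> strict_antimono_on {0..1} (\<lambda>t. k t $ j)"
proof (cases "x $ j \<le> y $ j")
  case True
  have "k s $ j < k t $ j" if st: "0 \<le> s" "s < t" "t \<le> 1" for s t
  proof -
    obtain p q where "s \<le> p" "p \<le> q" "q \<le> t" "k p $ j \<noteq> k q $ j" using ne[OF st] by blast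
    then show ?thesis
      using directed_mono(1)[OF k _ _ _ True, of s p] directed_mono(1)[OF k _ _ _ True, of p q]
        directed_mono(1)[OF k _ _ _ True, of q t] st by linarith
  qed
  then show ?thesis by (auto simp: monotone_on_def)
next
  case False
  then have le: "y $ j \<le> x $ j" by simp
  have "k t $ j < k s $ j" if st: "0 \<le> s" "s < t" "t \<le> 1" for s t
  proof -
    obtain p q where "s \<le> p" "p \<le> q" "q \<le> t" "k p $ j \<noteq> k q $ j" using ne[OF st] by blast
    then show ?thesis
      using directed_mono(2)[OF k _ _ _ le, of s p] directed_mono(2)[OF k _ _ _ le, of p q]
        directed_mono(2)[OF k _ _ _ le, of q t] st by linarith
  qed
  then show ?thesis by (auto simp: monotone_on_def)
qed

section \<open>The characterisation\<close>

lemma approachable_imp_strictly_l1_convex: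
  fixes M :: "(real ^ 3) set"
  assumes M: "approachable M" "closed M"
  shows "strictly_l1_convex M"
proof -
  define c where "c = 1 - 1 / (4 * real CARD(3))"
  have c: "0 \<le> c" "c < 1" by (auto simp: c_def)
  have "l1_convex M"
    unfolding l1_convex_def
  proof (intro ballI)
    fix x y assume xy: "x \<in> M" "y \<in> M"
    have mid: "\<exists>z\<in>M. True \<and> True \<and> z \<in> l1_interval x y \<and>
        l1_dist x z \<le> c * l1_dist x y \<and> l1_dist z y \<le> c * l1_dist x y"
      if "x \<in> M" "y \<in> M" for x y
      using approachable_midpoint[OF M that] by (simp add: c_def)
    obtain k where "path k" "path_image k \<subseteq> M" "pathstart k = x" "pathfinish k = y" "directed k x y"
      using bisection_path[OF M(2) c, of "\<lambda>_ _. True" x y] mid xy by blast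
    then show "\<exists>k. path k \<and> path_image k \<subseteq> M \<and> pathstart k = x \<and> pathfinish k = y \<and>
        (\<forall>j. mono_on {0..1} (\<lambda>t. k t $ j) \<or> antimono_on {0..1} (\<lambda>t. k t $ j))"
      using directed_monotone by blast
  qed
  moreover have "\<exists>k. path k \<and> path_image k \<subseteq> M \<and> pathstart k = x \<and> pathfinish k = y \<and>
      (\<forall>j. mono_on {0..1} (\<lambda>t. k t $ j) \<or> antimono_on {0..1} (\<lambda>t. k t $ j)) \<and>
      (\<forall>j. j \<notin> eqc M \<longrightarrow>
        strict_mono_on {0..1} (\<lambda>t. k t $ j) \<or> strict_antimono_on {0..1} (\<lambda>t. k t $ j))"
    if xy: "x \<in> M" "y \<in> M" and ne: "\<forall>j. j \<notin> eqc M \<longrightarrow> x $ j \<noteq> y $ j" for x y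
  proof -
    let ?Q = "\<lambda>x y. \<forall>j\<in>- eqc M. (x :: real ^ 3) $ j \<noteq> y $ j"
    have mid: "\<exists>z\<in>M. ?Q x z \<and> ?Q z y \<and> z \<in> l1_interval x y \<and>
        l1_dist x z \<le> c * l1_dist x y \<and> l1_dist z y \<le> c * l1_dist x y"
      if "x \<in> M" "y \<in> M" "?Q x y" for x y
    proof -
      have "u $ j = v $ j" if "j \<notin> - eqc M" "u \<in> M" "v \<in> M" for j u v
        using that unfolding eqc_def by blast
      from approachable_strict_midpoint[OF M that(1,2) this bspec[OF that(3)]] show ?thesis
        unfolding c_def by blast
    qed
    obtain k where k: "path k" "path_image k \<subseteq> M" "pathstart k = x" "pathfinish k = y" "directed k x y"
      "\<And>s t. 0 \<le> s \<Longrightarrow> s < t \<Longrightarrow> t \<le> 1 \<Longrightarrow> \<exists>p q. s \<le> p \<and> p \<le> q \<and> q \<le> t \<and> ?Q (k p) (k q)"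
    proof (rule bisection_path[OF M(2) c mid xy])
      show "?Q x y" using ne by simp
    qed blast+
    have "strict_mono_on {0..1} (\<lambda>t. k t $ j) \<or> strict_antimono_on {0..1} (\<lambda>t. k t $ j)"
      if "j \<notin> eqc M" for j
    proof (rule directed_strict_monotone[OF k(5)])
      fix s t :: real assume "0 \<le> s" "s < t" "t \<le> 1"
      from k(6)[OF this] show "\<exists>p q. s \<le> p \<and> p \<le> q \<and> q \<le> t \<and> k p $ j \<noteq> k q $ j"
        using that by blast
    qed
    then show ?thesis using k(1-5) directed_monotone by blast
  qed
  ultimately show ?thesis unfolding strictly_l1_convex_def by blast
qed

theorem theorem1:
  fixes M :: "(real ^ 3) set"
  assumes "M \<noteq> {}" and "closed M"
  shows "strict_sun infnorm M \<longleftrightarrow> strictly_l1_convex M \<and> \<not> R3_cross M"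
proof
  assume "strict_sun infnorm M"
  then have "approachable M" by (rule strict_sun_imp_approachable)
  then show "strictly_l1_convex M \<and> \<not> R3_cross M"
    using approachable_imp_strictly_l1_convex approachable_not_R3_cross assms(2) by blast
next
  assume "strictly_l1_convex M \<and> \<not> R3_cross M"
  then have "approachable M" using strictly_l1_convex_imp_approachable by blast
  then show "strict_sun infnorm M" using assms by (intro approachable_imp_strict_sun)
qed

end
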